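(* The group $PSL_2(\mathbb{Z})$ is PA-recognizable. Hence $\mathbb{Z}\times PSL_2(\mathbb{Z})$ admits a strongly aperiodic subshift of finite type.
   Context: Piecewise affine rational homeomorphisms of $[0,1]_{/0\sim 1}$ (the circle obtained from $[0,1]$ by identifying $0$ and $1$): such a homeomorphism $f$ is given by rationals $0=p_0<p_1<\dots<p_n=1$ and, on each interval $[p_i,p_{i+1}]$, an affine map $f_i(x)=a_ix+b_i$ with rational coefficients and values in $[0,1]$, such that consecutive pieces (cyclically, indices modulo $n$) agree modulo $0\sim 1$ at their common boundary points and the resulting map $f$ is injective modulo $0\sim 1$. A finitely generated group $G$ is PA-recognizable if there is a finite set $\mathcal F$ of piecewise affine rational homeomorphisms of $[0,1]_{/0\sim1}$ such that, $\Gamma$ denoting the group (under composition) generated by $\mathcal F$: (A) $\Gamma$ is isomorphic to $G$; (B) for every $t\in[0,1]_{/0\sim1}$ and $g\in\Gamma$, if $g(f(t))=f(t)$ for all $f\in\Gamma$, then $g$ is the identity. Subshifts: let $H$ be a finitely generated group and $A$ a finite alphabet. $H$ acts on $A^H$ by $(gx)_h=x_{g^{-1}h}$. A subshift of finite type (SFT) over $H$ is a set $X\subseteq A^H$ for which there is a finite set $L$ of maps $w:D_w\to A$ ($D_w\subseteq H$ finite) such that $X$ is the set of all $x\in A^H$ such that for every $g\in H$ and $w\in L$ the restriction of $gx$ to $D_w$ differs from $w$. Let $Stab(x)=\{g\in H:gx=x\}$. A subshift $X$ is strongly aperiodic if it is nonempty and $Stab(x)$ is finite for every $x\in X$. "$H$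 admits" such an SFT means one exists over some finite alphabet. *)

theory Defs
  imports
    "HOL-Algebra.Bij"
    "HOL-Algebra.Group_Action"
    "HOL-Algebra.Elementary_Groups"
    "HOL-Analysis.Determinants"
begin

section \<open>Piecewise affine rational homeomorphisms of the circle\<close>

text \<open>
  A point of \<open>[0,1]\<close> with \<open>0\<close> and \<open>1\<close> identified is represented by its unique representative
  in \<open>{0..<1}\<close>; the projection from \<open>[0,1]\<close> is \<^const>\<open>frac\<close>.
\<close>

definition circle :: "real set"
  where "circle = {0..<1}"

text \<open>
  The last condition is imposed on closed intervals, so at a breakpoint (and at \<open>1 \<sim> 0\<close>) both
  adjacent pieces prescribe the value of \<open>f\<close>.  It therefore contains the requirement that
  cyclically consecutive pieces agree modulo \<open>0 \<sim> 1\<close>.  Membership in \<^const>\<open>Bij\<close> says that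
  \<open>f\<close> is a bijection of the circle, extended by \<^const>\<open>undefined\<close> outside of it (for
  a continuous map of the circle, surjectivity already follows from injectivity).
\<close>

definition PA_rational_homeo :: "(real \<Rightarrow> real) \<Rightarrow> bool"
  where "PA_rational_homeo f \<longleftrightarrow>
    f \<in> Bij circle \<and>
    (\<exists>(n::nat) (p::nat \<Rightarrow> real) (a::nat \<Rightarrow> real) (b::nat \<Rightarrow> real).
       p 0 = 0 \<and> p n = 1 \<and> (\<forall>i<n. p i < p (Suc i)) \<and>
       (\<forall>i\<le>n. p i \<in> \<rat>) \<and> (\<forall>i<n. a i \<in> \<rat> \<and> b i \<in> \<rat>) \<and>
       (\<forall>i<n. \<forall>x\<in>{p i..p (Suc i)}.
          a i * x + b i \<in> {0..1} \<and> f (frac x) = frac (a i * x + b i)))"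


section \<open>PA-recognizable groups\<close>

definition finitely_generated_group :: "('a, 'b) monoid_scheme \<Rightarrow> bool"
  where "finitely_generated_group G \<longleftrightarrow>
    group G \<and> (\<exists>S. finite S \<and> S \<subseteq> carrier G \<and> generate G S = carrier G)"

definition PA_recognizable :: "('a, 'b) monoid_scheme \<Rightarrow> bool"
  where "PA_recognizable G \<longleftrightarrow>
    finitely_generated_group G \<and>
    (\<exists>F. finite F \<and> (\<forall>f\<in>F. PA_rational_homeo f) \<and>
       (let \<Gamma> = subgroup_generated (BijGroup circle) F in
          \<Gamma> \<cong> G \<and>
          (\<forall>t\<in>circle. \<forall>g\<in>carrier \<Gamma>.
             (\<forall>f\<in>carrier \<Gamma>. g (f t) = f t) \<longrightarrow> g = \<one>\<^bsub>\<Gamma>\<^esub>)))"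


section \<open>Subshifts of finite type over a group\<close>

definition full_shift :: "('g, 'm) monoid_scheme \<Rightarrow> 'a set \<Rightarrow> ('g \<Rightarrow> 'a) set"
  where "full_shift H A = carrier H \<rightarrow>\<^sub>E A"

definition shift :: "('g, 'm) monoid_scheme \<Rightarrow> 'g \<Rightarrow> ('g \<Rightarrow> 'a) \<Rightarrow> ('g \<Rightarrow> 'a)"
  where "shift H g x = (\<lambda>h\<in>carrier H. x (inv\<^bsub>H\<^esub> g \<otimes>\<^bsub>H\<^esub> h))"

text \<open>A forbidden pattern \<open>w : D \<rightarrow> A\<close> is the pair \<open>(D, w)\<close> of its finite domain and an
  extensional function on it.\<close>

definition patterns :: "('g, 'm) monoid_scheme \<Rightarrow> 'a set \<Rightarrow> ('g set \<times> ('g \<Rightarrow> 'a)) set"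
  where "patterns H A = {(D, w). finite D \<and> D \<subseteq> carrier H \<and> w \<in> D \<rightarrow>\<^sub>E A}"

definition is_SFT :: "('g, 'm) monoid_scheme \<Rightarrow> 'a set \<Rightarrow> ('g \<Rightarrow> 'a) set \<Rightarrow> bool"
  where "is_SFT H A X \<longleftrightarrow>
    (\<exists>L. finite L \<and> L \<subseteq> patterns H A \<and>
       X = {x \<in> full_shift H A. \<forall>g\<in>carrier H. \<forall>(D, w)\<in>L. restrict (shift H g x) D \<noteq> w})"

definition strongly_aperiodic :: "('g, 'm) monoid_scheme \<Rightarrow> ('g \<Rightarrow> 'a) set \<Rightarrow> bool"
  where "strongly_aperiodic H X \<longleftrightarrow>
    X \<noteq> {} \<and> (\<forall>x\<in>X. finite (stabilizer H (shift H) x))"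

text \<open>Up to renaming of symbols, every finite alphabet is a finite set of natural numbers.\<close>

definition admits_strongly_aperiodic_SFT :: "('g, 'm) monoid_scheme \<Rightarrow> bool"
  where "admits_strongly_aperiodic_SFT H \<longleftrightarrow>
    finitely_generated_group H \<and>
    (\<exists>(A::nat set) X. finite A \<and> is_SFT H A X \<and> strongly_aperiodic H X)"


section \<open>The modular group\<close>

definition SL2Z :: "(int^2^2) monoid"
  where "SL2Z = \<lparr>carrier = {M. det M = 1}, monoid.mult = (**), one = mat 1\<rparr>"

definition PSL2Z :: "(int^2^2) set monoid"
  where "PSL2Z = SL2Z Mod {mat 1, - mat 1}"

end

theory Submission
  imports Defs
begin

text \<open>
  Write \<open>a\<close>, \<open>b\<close> for the generators of orders two and three of the modular group, the free
  product of their cyclic groups.  Everything below rests on one combinatorial structure: a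
  half \<open>I\<close> of a set \<open>\<Omega>\<close> on which a group generated by such \<open>a\<close> and \<open>b\<close> acts, where \<open>a\<close> exchanges \<open>I\<close>
  and its complement, and every orbit of \<open>b\<close> meets \<open>I\<close> exactly once.  By ping-pong, only the
  identity acts trivially on \<open>\<Omega>\<close>, provided that \<open>\<Omega>\<close> is not empty (theorem \<open>faithful\<close>).

  \<^emph>\<open>Recognizability.\<close>  On the circle, let \<open>a\<close> be the half turn and let \<open>b\<close> permute the arcs \<open>[0,1/2)\<close>,
  \<open>[1/2,3/4)\<close>, \<open>[3/4,1)\<close> cyclically by affine maps; the half is \<open>I = [0,1/2)\<close>.  In the modular group,
  multiplication from the right admits a half that is read off from the signs in the first row
  of a matrix.  Two groups with such actions are isomorphic: in the subgroup of their product
  generated by the pairs \<open>(a, a')\<close>, \<open>(b, b')\<close>, an element that one projection kills acts trivially, so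
  both projections are isomorphisms.  Condition (B) is faithfulness once more, now for the action
  on a single orbit, whose intersection with \<open>[0,1/2)\<close> is a half of it.

  \<^emph>\<open>The subshift.\<close>  The half of the group orients the tree of triangles \<open>{g, gb, gb\<^sup>2}\<close> toward an end:
  each triangle has one exit \<open>u\<close>, leading to the triangle of \<open>ua\<close>.  Such an orientation is enforced by
  local rules, any two forward paths merge, and no path closes up.  Over each triangle a
  configuration carries a two-sided row of digits 1, 2, 3, and along the orientation
  a carry automaton forces the mean of the row to be multiplied by \<open>2\<close> or \<open>2/3\<close>, the choice being
  constant along the row.  After \<open>d > 0\<close> steps the factor is \<open>2\<^sup>d/3\<^sup>i\<close>, which is never \<open>1\<close>.  If a
  configuration is fixed by \<open>(m, h)\<close> with \<open>h \<noteq> 1\<close>, then merging the paths from \<open>g\<close> and \<open>hg\<close> yields a row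
  that is a shift of the row some \<open>d > 0\<close> steps later, which is absurd.  If \<open>h = 1\<close> and \<open>m \<noteq> 0\<close>, the sums
  over a period are bounded positive integers divisible by arbitrarily high powers of two.
  Hence all stabilizers are trivial.  A configuration exists because the map \<open>t \<mapsto> 2t\<close> or \<open>2t/3\<close> has a
  two-sided orbit in \<open>[1,3)\<close>, whose Beatty differences \<open>\<lfloor>(n+1)t\<rfloor> - \<lfloor>nt\<rfloor>\<close> fill the rows according to the
  height along the orientation.
\<close>

section \<open>Groups generated by an involution and an element of order three\<close>

locale modular_generators = group G for G :: "('g, 'm) monoid_scheme" (structure) +
  fixes a b :: 'g
  assumes a_closed [simp]: "a \<in> carrier G" and b_closed [simp]: "b \<in> carrier G"
    and a_square: "a \<otimes> a = \<one>" and b_cube: "b \<otimes> (b \<otimes> b) = \<one>"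
    and generators: "generate G {a, b} = carrier G"
begin

lemma a_cancel [simp]: "x \<in> carrier G \<Longrightarrow> a \<otimes> (a \<otimes> x) = x"
  by (simp add: a_square flip: m_assoc)

lemma b_cancel [simp]: "x \<in> carrier G \<Longrightarrow> b \<otimes> (b \<otimes> (b \<otimes> x)) = x"
  using b_cube m_assoc[of b "b \<otimes> b" x] by (simp add: m_assoc)

lemma inv_a: "inv a = a"
  by (simp add: a_square inv_equality)

lemma inv_b: "inv b = b \<otimes> b"
  by (simp add: b_cube m_assoc inv_equality)

text \<open>
  These are the alternating words that begin and end with a power of \<open>b\<close>.  Up to conjugation by \<open>a\<close>
  and multiplication by it, they account for all elements, so the ping-pong argument has to treat
  only this one shape.
\<close>
inductive_set b_words :: "'g set"
  where
    b_word1: "b \<in> b_words"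
  | b_word2: "b \<otimes> b \<in> b_words"
  | b_word_step1: "x \<in> b_words \<Longrightarrow> b \<otimes> (a \<otimes> x) \<in> b_words"
  | b_word_step2: "x \<in> b_words \<Longrightarrow> b \<otimes> (b \<otimes> (a \<otimes> x)) \<in> b_words"

lemma b_words_closed [simp]: "x \<in> b_words \<Longrightarrow> x \<in> carrier G"
  by (induction rule: b_words.induct) auto

text \<open>
  The listed elements are stable under left multiplication by \<open>a\<close> and by \<open>b\<close>.
\<close>
lemma normal_form:
  assumes "x \<in> carrier G"
  obtains "x = \<one>" | "x = a"
  | w where "w \<in> b_words" "x = w" | w where "w \<in> b_words" "x = a \<otimes> w"
  | w where "w \<in> b_words" "x = w \<otimes> a" | w where "w \<in> b_words" "x = a \<otimes> (w \<otimes> a)"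
proof -
  define N where "N = {\<one>, a} \<union> (\<Union>w\<in>b_words. {w, a \<otimes> w, w \<otimes> a, a \<otimes> (w \<otimes> a)})"
  have N_closed: "N \<subseteq> carrier G"
    by (auto simp: N_def)
  have aN: "a \<otimes> y \<in> N" if "y \<in> N" for y
    using that by (auto simp: N_def a_square)
  have bw: "b \<otimes> w = \<one> \<or> b \<otimes> w \<in> b_words \<or> (\<exists>v\<in>b_words. b \<otimes> w = a \<otimes> v)"
    if "w \<in> b_words" for w
    using that by (cases rule: b_words.cases) (auto simp: b_cube intro: b_words.intros)
  have bN: "b \<otimes> y \<in> N" if "y \<in> N" for y
  proof -
    have b_w: "b \<otimes> w \<in> N" if "w \<in> b_words" for w
      using bw[OF that] by (auto simp: N_def)
    have b_wa: "b \<otimes> (w \<otimes> a) \<in> N" if "w \<in> b_words" for w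
    proof -
      have "b \<otimes> (w \<otimes> a) = (b \<otimes> w) \<otimes> a" using that by (simp add: m_assoc)
      moreover have "(b \<otimes> w) \<otimes> a \<in> N" using bw[OF that] by (auto simp: N_def m_assoc)
      ultimately show ?thesis by simp
    qed
    have b_aw: "b \<otimes> (a \<otimes> w) \<in> N" and b_awa: "b \<otimes> (a \<otimes> (w \<otimes> a)) \<in> N" if "w \<in> b_words" for w
    proof -
      have "b \<otimes> (a \<otimes> w) \<in> b_words" using that by (rule b_word_step1)
      moreover have "b \<otimes> (a \<otimes> (w \<otimes> a)) = (b \<otimes> (a \<otimes> w)) \<otimes> a" using that by (simp add: m_assoc)
      ultimately show "b \<otimes> (a \<otimes> w) \<in> N" "b \<otimes> (a \<otimes> (w \<otimes> a)) \<in> N" by (auto simp: N_def)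
    qed
    from that consider "y \<in> {\<one>, a}" | w where "w \<in> b_words" "y \<in> {w, a \<otimes> w, w \<otimes> a, a \<otimes> (w \<otimes> a)}"
      by (auto simp: N_def)
    then show ?thesis
    proof cases
      case 1 then show ?thesis using b_word1 by (auto simp: N_def)
    next
      case (2 w) then show ?thesis using b_w b_wa b_aw b_awa by auto
    qed
  qed
  have "x \<in> generate G {a, b}" using assms generators by simp
  then have "\<forall>y\<in>N. x \<otimes> y \<in> N"
  proof (induction rule: generate.induct)
    case one then show ?case using N_closed by auto
  next
    case (incl h) then show ?case using aN bN by auto
  next
    case (inv h)
    then show ?case using aN bN N_closed by (auto simp: inv_a inv_b m_assoc subset_iff)
  next
    case (eng h k)
    then have "h \<in> carrier G" "k \<in> carrier G" using generators by auto
    then show ?case using eng N_closed by (auto simp: m_assoc subset_iff)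
  qed
  then have "x \<otimes> \<one> \<in> N" by (auto simp: N_def)
  then have "x \<in> N" using assms by simp
  then show thesis using that by (auto simp: N_def)
qed

end

section \<open>Ping-pong\<close>

text \<open>
  The action of the free product on two halves, in its exact form: \<open>I\<close> is a fundamental domain for
  \<open>a\<close> and one for \<open>b\<close>.  The last assumption suffices for disjointness of all three translates of
  \<open>I\<close>, because it can be applied to \<open>b\<omega>\<close> and \<open>b\<^sup>2\<omega>\<close> as well.
\<close>
locale modular_action = modular_generators G a b for G :: "('g, 'm) monoid_scheme" (structure) and a b +
  fixes \<Omega> I :: "'w set" and act :: "'g \<Rightarrow> 'w \<Rightarrow> 'w"
  assumes act_closed: "x \<in> carrier G \<Longrightarrow> \<omega> \<in> \<Omega> \<Longrightarrow> act x \<omega> \<in> \<Omega>"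
    and act_mult: "x \<in> carrier G \<Longrightarrow> y \<in> carrier G \<Longrightarrow> \<omega> \<in> \<Omega> \<Longrightarrow> act (x \<otimes> y) \<omega> = act x (act y \<omega>)"
    and act_one: "\<omega> \<in> \<Omega> \<Longrightarrow> act \<one> \<omega> = \<omega>"
    and a_swaps: "\<omega> \<in> \<Omega> \<Longrightarrow> act a \<omega> \<in> I \<longleftrightarrow> \<omega> \<notin> I"
    and b_covers: "\<omega> \<in> \<Omega> \<Longrightarrow> \<omega> \<in> I \<or> act b \<omega> \<in> I \<or> act b (act b \<omega>) \<in> I"
    and b_disjoint: "\<omega> \<in> \<Omega> \<Longrightarrow> \<omega> \<in> I \<Longrightarrow> act b \<omega> \<notin> I"
begin

lemma act_a_a: "\<omega> \<in> \<Omega> \<Longrightarrow> act a (act a \<omega>) = \<omega>"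
  by (metis a_closed a_square act_mult act_one)

lemma act_b_b_b: "\<omega> \<in> \<Omega> \<Longrightarrow> act b (act b (act b \<omega>)) = \<omega>"
  by (metis b_closed b_cube act_mult act_one act_closed m_closed)

text \<open>
  A word beginning and ending with a power of \<open>b\<close> maps the half \<open>I\<close> into one of its translates
  \<open>bI\<close>, \<open>b\<^sup>2I\<close>, as given by its first letter.  Membership in \<open>b\<^sup>2I\<close> and in \<open>bI\<close> is expressed by applying
  \<open>b\<close> once or twice more, which avoids inverses.
\<close>
lemma b_word_ping_pong:
  assumes "w \<in> b_words"
  obtains "\<And>\<omega>. \<omega> \<in> \<Omega> \<Longrightarrow> \<omega> \<in> I \<Longrightarrow> act b (act w \<omega>) \<in> I"
  | "\<And>\<omega>. \<omega> \<in> \<Omega> \<Longrightarrow> \<omega> \<in> I \<Longrightarrow> act b (act b (act w \<omega>)) \<in> I"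
proof -
  have "(\<forall>\<omega>\<in>\<Omega> \<inter> I. act b (act w \<omega>) \<in> I) \<or> (\<forall>\<omega>\<in>\<Omega> \<inter> I. act b (act b (act w \<omega>)) \<in> I)"
    using assms
  proof (induction rule: b_words.induct)
    case b_word1
    then show ?case by (auto simp: act_b_b_b)
  next
    case b_word2
    then show ?case by (auto simp: act_mult act_b_b_b)
  next
    case (b_word_step1 x)
    then have "act x \<omega> \<notin> I" if "\<omega> \<in> \<Omega> \<inter> I" for \<omega>
      using that by (metis IntD1 act_b_b_b act_closed b_closed b_disjoint b_words_closed)
    then have "act a (act x \<omega>) \<in> I" if "\<omega> \<in> \<Omega> \<inter> I" for \<omega>
      using that b_word_step1 by (simp add: a_swaps act_closed)
    then show ?case using b_word_step1
      by (auto simp: act_mult act_b_b_b act_closed)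
  next
    case (b_word_step2 x)
    then have "act x \<omega> \<notin> I" if "\<omega> \<in> \<Omega> \<inter> I" for \<omega>
      using that by (metis IntD1 act_b_b_b act_closed b_closed b_disjoint b_words_closed)
    then have "act a (act x \<omega>) \<in> I" if "\<omega> \<in> \<Omega> \<inter> I" for \<omega>
      using that b_word_step2 by (simp add: a_swaps act_closed)
    then show ?case using b_word_step2
      by (auto simp: act_mult act_b_b_b act_closed)
  qed
  then show thesis using that by auto
qed

lemma half_nonempty: "\<Omega> \<noteq> {} \<Longrightarrow> \<exists>\<omega>\<in>\<Omega>. \<omega> \<in> I"
  using a_swaps act_closed by (metis a_closed ex_in_conv)

lemma b_word_moves:
  assumes "w \<in> b_words" "\<Omega> \<noteq> {}"
  shows "\<exists>\<omega>\<in>\<Omega>. act w \<omega> \<noteq> \<omega>"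
proof -
  obtain \<omega> where \<omega>: "\<omega> \<in> \<Omega>" "\<omega> \<in> I" using half_nonempty assms by blast
  from assms(1) show ?thesis
    by (cases rule: b_word_ping_pong) (metis \<omega> b_disjoint act_b_b_b act_closed b_closed)+
qed

text \<open>
  The image of \<open>I\<close> under \<open>a\<close> is the whole complement of \<open>I\<close>, but under a word it is contained in only
  one of the two pieces of that complement.
\<close>
lemma b_word_differs_from_a:
  assumes w: "w \<in> b_words" and "\<Omega> \<noteq> {}"
  shows "\<exists>\<omega>\<in>\<Omega>. act w \<omega> \<noteq> act a \<omega>"
proof -
  obtain \<omega> where \<omega>: "\<omega> \<in> \<Omega>" "\<omega> \<in> I" using half_nonempty assms by blast
  have *: "\<exists>z\<in>\<Omega>. z \<notin> I \<and> act b z \<notin> I" "\<exists>z\<in>\<Omega>. z \<notin> I \<and> act b (act b z) \<notin> I"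
    by (metis \<omega> b_disjoint act_b_b_b act_closed b_closed)+
  have **: "act a z \<in> I" "act a z \<in> \<Omega>" "act a (act a z) = z" if "z \<in> \<Omega>" "z \<notin> I" for z
    using that by (auto simp: a_swaps act_a_a act_closed)
  from w show ?thesis
    by (cases rule: b_word_ping_pong) (metis * **)+
qed

text \<open>
  A word of the form \<open>aw\<close> or \<open>wa\<close> that acts trivially would make \<open>w\<close> act like \<open>a\<close>; a conjugate \<open>awa\<close>
  would make \<open>w\<close> itself act trivially.
\<close>
theorem faithful:
  assumes "\<Omega> \<noteq> {}" and x: "x \<in> carrier G" and fixes_all: "\<And>\<omega>. \<omega> \<in> \<Omega> \<Longrightarrow> act x \<omega> = \<omega>"
  shows "x = \<one>"
  using x
proof (cases rule: normal_form)
  case 2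
  then show ?thesis using half_nonempty assms a_swaps by metis
next
  case (3 w)
  then show ?thesis using b_word_moves assms by metis
next
  case (4 w)
  have "act w \<omega> = act a \<omega>" if "\<omega> \<in> \<Omega>" for \<omega>
    using 4 that fixes_all[OF that] by (metis a_closed act_a_a act_closed act_mult b_words_closed)
  then show ?thesis using b_word_differs_from_a 4 assms by metis
next
  case (5 w)
  have "act w \<omega> = act a \<omega>" if "\<omega> \<in> \<Omega>" for \<omega>
    using 5 that fixes_all[of "act a \<omega>"] by (simp add: act_a_a act_closed act_mult)
  then show ?thesis using b_word_differs_from_a 5 assms by metis
next
  case (6 w)
  have "act w \<omega> = \<omega>" if "\<omega> \<in> \<Omega>" for \<omega>
  proof -
    have "act a (act w \<omega>) = act a \<omega>"
      using 6 that fixes_all[of "act a \<omega>"] by (simp add: act_a_a act_closed act_mult)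
    then show ?thesis using act_a_a act_closed 6 that by (metis b_words_closed)
  qed
  then show ?thesis using b_word_moves 6 assms by metis
qed

text \<open>
  The universal property of the free product: an element of the kernel acts trivially through \<open>p\<close>,
  and faithfulness applies to the source \<open>D\<close>.
\<close>
lemma hom_from_modular_generators_is_iso:
  assumes D: "modular_generators D s t" and p: "p \<in> hom D G" "p s = a" "p t = b" and "\<Omega> \<noteq> {}"
  shows "p \<in> iso D G"
proof -
  interpret D: modular_generators D s t by (rule D)
  interpret p: group_hom D G p
    using p by (simp add: group_hom_def group_hom_axioms_def D.is_group is_group)
  interpret D: modular_action D s t \<Omega> I "\<lambda>x. act (p x)"
    by unfold_locales (use p in \<open>auto simp: act_closed act_mult act_one a_swaps b_disjoint dest: b_covers\<close>)
  have "y \<in> p ` carrier D" if "y \<in> generate G {a, b}" for y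
    using that
  proof (induction rule: generate.induct)
    case one
    then show ?case by (metis D.one_closed imageI p.hom_one)
  next
    case (incl h)
    then show ?case using p by auto
  next
    case (inv h)
    then show ?case using p by (metis D.a_closed D.b_closed D.inv_closed image_eqI insert_iff p.hom_inv singletonD)
  next
    case (eng h k)
    then obtain x y where "x \<in> carrier D" "y \<in> carrier D" "h = p x" "k = p y" by auto
    then show ?case by (intro image_eqI[of _ _ "x \<otimes>\<^bsub>D\<^esub> y"]) auto
  qed
  moreover have "x = \<one>\<^bsub>D\<^esub>" if "x \<in> carrier D" "p x = \<one>" for x
    using D.faithful[OF \<open>\<Omega> \<noteq> {}\<close> that(1)] that act_one by auto
  ultimately show ?thesis
    using generators by (auto simp: p.iso_iff)
qed

end

text \<open>
  The graph of the isomorphism is generated by the pairs of corresponding generators.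
\<close>
theorem modular_groups_isomorphic:
  assumes "modular_action G a b \<Omega> I act" "\<Omega> \<noteq> {}" and "modular_action G' a' b' \<Omega>' I' act'" "\<Omega>' \<noteq> {}"
  shows "G \<cong> G'"
proof -
  interpret G: modular_action G a b \<Omega> I act by fact
  interpret G': modular_action G' a' b' \<Omega>' I' act' by fact
  define P where "P = G \<times>\<times> G'"
  define D where "D = subgroup_generated P {(a, a'), (b, b')}"
  interpret P: group P unfolding P_def by (intro DirProd_group G.is_group G'.is_group)
  have sub: "{(a, a'), (b, b')} \<subseteq> carrier P" by (auto simp: P_def)
  have carD: "carrier D = generate P {(a, a'), (b, b')}"
    using sub by (simp add: D_def carrier_subgroup_generated Int_absorb1)
  have gen: "generate D {(a, a'), (b, b')} = carrier D"
  proof -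
    have "D = subgroup_generated D {(a, a'), (b, b')}" by (simp add: D_def)
    then have "carrier D = generate D (carrier D \<inter> {(a, a'), (b, b')})"
      by (metis carrier_subgroup_generated)
    moreover have "carrier D \<inter> {(a, a'), (b, b')} = {(a, a'), (b, b')}"
      by (auto simp: carD intro: generate.incl)
    ultimately show ?thesis by simp
  qed
  have carP: "carrier D \<subseteq> carrier P" using P.generate_in_carrier[OF sub] carD by auto
  have D: "modular_generators D (a, a') (b, b')"
  proof (unfold modular_generators_def modular_generators_axioms_def, intro conjI)
    show "group D" by (simp add: D_def)
    show "(a, a') \<in> carrier D" "(b, b') \<in> carrier D" by (auto simp: carD intro: generate.incl)
    show "(a, a') \<otimes>\<^bsub>D\<^esub> (a, a') = \<one>\<^bsub>D\<^esub>" by (simp add: D_def P_def G.a_square G'.a_square)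
    show "(b, b') \<otimes>\<^bsub>D\<^esub> ((b, b') \<otimes>\<^bsub>D\<^esub> (b, b')) = \<one>\<^bsub>D\<^esub>" by (simp add: D_def P_def G.b_cube G'.b_cube)
  qed (rule gen)
  have "fst \<in> hom D G" "snd \<in> hom D G'"
    using carP by (auto simp: hom_def D_def P_def mult_DirProd')
  then have "fst \<in> iso D G" "snd \<in> iso D G'"
    using G.hom_from_modular_generators_is_iso[OF D] G'.hom_from_modular_generators_is_iso[OF D] assms by auto
  then have "D \<cong> G" "D \<cong> G'" by (auto simp: is_iso_def)
  then show ?thesis
    using group.iso_sym iso_trans by (metis D_def P.group_subgroup_generated)
qed

section \<open>Flows toward an end\<close>

text \<open>
  The Cayley graph consists of triangles \<open>{g, gb, gb\<^sup>2}\<close> joined by edges \<open>{g, ga}\<close>.  The predicate \<open>E\<close>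
  marks one vertex of each triangle as its exit, and one endpoint of each edge as its source.  The
  conditions involve right multiplication by generators only, so that they are local rules for
  a subshift and are invariant under left translation.
\<close>
locale modular_flow = modular_generators G a b for G :: "('g, 'm) monoid_scheme" (structure) and a b +
  fixes E :: "'g \<Rightarrow> bool"
  assumes E_a: "g \<in> carrier G \<Longrightarrow> E (g \<otimes> a) \<longleftrightarrow> \<not> E g"
    and E_covers: "g \<in> carrier G \<Longrightarrow> E g \<or> E (g \<otimes> b) \<or> E (g \<otimes> b \<otimes> b)"
    and E_disjoint: "g \<in> carrier G \<Longrightarrow> E g \<Longrightarrow> \<not> E (g \<otimes> b)"
begin

lemma right_a_a [simp]: "g \<in> carrier G \<Longrightarrow> g \<otimes> a \<otimes> a = g"
  by (simp add: m_assoc a_square)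

lemma right_b_b_b [simp]: "g \<in> carrier G \<Longrightarrow> g \<otimes> b \<otimes> b \<otimes> b = g"
  by (simp add: m_assoc b_cube)

text \<open>
  The exits form a half of the group for right multiplication, so that ping-pong is available.
\<close>
lemma modular_action_right: "modular_action G a b (carrier G) {g. E g} (\<lambda>x g. g \<otimes> inv x)"
proof
  fix g assume g: "g \<in> carrier G"
  have bb: "g \<otimes> (b \<otimes> b) \<otimes> (b \<otimes> b) = g \<otimes> b"
    using g by (simp add: m_assoc)
  show "g \<in> {g. E g} \<or> g \<otimes> inv b \<in> {g. E g} \<or> g \<otimes> inv b \<otimes> inv b \<in> {g. E g}"
    using E_covers[OF g] g unfolding inv_b bb by (auto simp: m_assoc)
  show "g \<otimes> inv b \<notin> {g. E g}" if "g \<in> {g. E g}"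
    using E_disjoint[of "g \<otimes> b \<otimes> b"] that g by (auto simp: inv_b m_assoc b_cube)
qed (auto simp: inv_a inv_mult_group m_assoc E_a)

sublocale regular: modular_action G a b "carrier G" "{g. E g}" "\<lambda>x g. g \<otimes> inv x"
  by (rule modular_action_right)

definition gate :: "'g \<Rightarrow> 'g"
  where "gate g = (if E g then g else if E (g \<otimes> b) then g \<otimes> b else g \<otimes> b \<otimes> b)"

text \<open>
  The flow passes from a triangle to the next one through the exit; its value is the entry point
  into the new triangle.
\<close>
definition flow :: "'g \<Rightarrow> 'g"
  where "flow g = gate g \<otimes> a"

lemma gate_closed [simp]: "g \<in> carrier G \<Longrightarrow> gate g \<in> carrier G"
  by (simp add: gate_def)

lemma E_gate: "g \<in> carrier G \<Longrightarrow> E (gate g)"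
  using E_covers by (auto simp: gate_def)

lemma gate_b: "g \<in> carrier G \<Longrightarrow> gate (g \<otimes> b) = gate g"
  using E_disjoint[of g] E_disjoint[of "g \<otimes> b"] E_disjoint[of "g \<otimes> b \<otimes> b"] E_covers[of g]
  by (auto simp: gate_def)

lemma flow_closed [simp]: "g \<in> carrier G \<Longrightarrow> flow g \<in> carrier G"
  by (simp add: flow_def)

lemma flow_funpow_closed [simp]: "g \<in> carrier G \<Longrightarrow> (flow ^^ k) g \<in> carrier G"
  by (induction k) auto

lemma flow_b: "g \<in> carrier G \<Longrightarrow> flow (g \<otimes> b) = flow g"
  by (simp add: flow_def gate_b)

lemma flow_gate: "E g \<Longrightarrow> flow g = g \<otimes> a"
  by (simp add: flow_def gate_def)

lemma not_E_flow: "g \<in> carrier G \<Longrightarrow> \<not> E (flow g)"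
  by (simp add: flow_def E_a E_gate)

text \<open>
  From a vertex that is not an exit, each step first turns by \<open>b\<close> or \<open>b\<^sup>2\<close> and then crosses an edge.
  The path thus spells an alternating word.
\<close>
lemma flow_funpow_word:
  assumes "g \<in> carrier G" "\<not> E g"
  shows "\<exists>w\<in>b_words. (flow ^^ Suc k) g = g \<otimes> (w \<otimes> a)"
  using assms
proof (induction k arbitrary: g)
  case 0
  then have "(flow ^^ Suc 0) g = g \<otimes> (b \<otimes> a) \<or> (flow ^^ Suc 0) g = g \<otimes> ((b \<otimes> b) \<otimes> a)"
    by (simp add: flow_def gate_def m_assoc)
  then show ?case
    using b_word1 b_word2 by blast
next
  case (Suc k)
  then obtain w where w: "w \<in> b_words" "(flow ^^ Suc k) (flow g) = flow g \<otimes> (w \<otimes> a)"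
    using not_E_flow flow_closed by blast
  have "(flow ^^ Suc (Suc k)) g = flow g \<otimes> (w \<otimes> a)"
    using w(2) by (simp only: funpow_Suc_right o_apply)
  moreover have "flow g \<otimes> (w \<otimes> a) = g \<otimes> (b \<otimes> (a \<otimes> w) \<otimes> a) \<or>
      flow g \<otimes> (w \<otimes> a) = g \<otimes> (b \<otimes> (b \<otimes> (a \<otimes> w)) \<otimes> a)"
    using Suc.prems w(1) by (auto simp: flow_def gate_def m_assoc)
  ultimately show ?case
    using w(1) b_words.intros(3,4) by metis
qed

text \<open>
  The path along a cycle would spell a word \<open>wa = 1\<close>, that is, \<open>w = a\<close>.
\<close>
lemma flow_no_cycle:
  assumes g: "g \<in> carrier G" and "k > 0"
  shows "(flow ^^ k) g \<noteq> g"
proof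
  assume cycle: "(flow ^^ k) g = g"
  then have "(flow ^^ k) (flow g) = flow g"
    by (metis funpow_swap1)
  moreover obtain j where "k = Suc j" using \<open>k > 0\<close> by (cases k) auto
  ultimately obtain w where w: "w \<in> b_words" "flow g \<otimes> (w \<otimes> a) = flow g"
    using flow_funpow_word[of "flow g" j] g not_E_flow by auto
  then have "w \<otimes> a = \<one>" using g by (simp add: r_cancel_one)
  then have "w = a" using w(1) by (metis a_closed b_words_closed inv_a inv_equality inv_inv)
  then show False using regular.b_word_differs_from_a[OF w(1)] by auto
qed

lemma flow_funpow_inj:
  assumes "g \<in> carrier G" "(flow ^^ i) g = (flow ^^ j) g"
  shows "i = j"
proof -
  have "\<not> i < j" if "(flow ^^ i) g = (flow ^^ j) g" for i j
  proof
    assume "i < j"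
    then have "(flow ^^ (j - i)) ((flow ^^ i) g) = (flow ^^ i) g"
      using that by (metis add_diff_inverse_nat add.commute funpow_add nat_less_le not_less o_apply)
    then show False using flow_no_cycle[of "(flow ^^ i) g" "j - i"] \<open>i < j\<close> assms by auto
  qed
  then show ?thesis using assms by (metis linorder_neqE_nat)
qed

text \<open>
  Merging is an equivalence relation.  It relates \<open>g\<close> to \<open>gb\<close>, which lies in the same triangle, and to
  \<open>ga\<close>, because the flow crosses that edge in one of its two directions.
\<close>
lemma flow_merges:
  assumes "g \<in> carrier G" "h \<in> carrier G"
  shows "\<exists>i j. (flow ^^ i) g = (flow ^^ j) h"
proof -
  define R where "R = (\<lambda>g h. \<exists>i j. (flow ^^ i) g = (flow ^^ j) h)"
  have sym: "R h g" if "R g h" for g h using that unfolding R_def by metis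
  have trans: "R g k" if gh: "R g h" and hk: "R h k" for g h k
  proof -
    from gh obtain i j where ij: "(flow ^^ i) g = (flow ^^ j) h" by (auto simp: R_def)
    from hk obtain i' j' where ij': "(flow ^^ i') h = (flow ^^ j') k" by (auto simp: R_def)
    have "(flow ^^ (i' + i)) g = (flow ^^ (i' + j)) h" by (simp add: funpow_add ij)
    also have "\<dots> = (flow ^^ (j + i')) h" by (simp add: add.commute)
    also have "\<dots> = (flow ^^ (j + j')) k" by (simp add: funpow_add ij')
    finally show ?thesis unfolding R_def by blast
  qed
  have Rb: "R g (g \<otimes> b)" if "g \<in> carrier G" for g
    unfolding R_def using flow_b[OF that] by (intro exI[of _ 1]) simp
  have Ra: "R g (g \<otimes> a)" if g: "g \<in> carrier G" for g
  proof (cases "E g")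
    case True
    then have "(flow ^^ 1) g = (flow ^^ 0) (g \<otimes> a)" by (simp add: flow_gate)
    then show ?thesis unfolding R_def by blast
  next
    case False
    then have "E (g \<otimes> a)" using E_a g by simp
    then have "(flow ^^ 0) g = (flow ^^ 1) (g \<otimes> a)" using g by (simp add: flow_gate)
    then show ?thesis unfolding R_def by blast
  qed
  have "\<forall>g\<in>carrier G. R g (g \<otimes> x)" if "x \<in> generate G {a, b}" for x
    using that
  proof (induction rule: generate.induct)
    case one
    then show ?case unfolding R_def by auto
  next
    case (incl h)
    then show ?case using Ra Rb by auto
  next
    case (inv h)
    have "R g (g \<otimes> b \<otimes> b)" if "g \<in> carrier G" for g
      using that by (intro trans[OF Rb Rb]) auto
    then show ?case using inv Ra by (auto simp: inv_a inv_b m_assoc)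
  next
    case (eng h k)
    then have hk: "h \<in> carrier G" "k \<in> carrier G" using generators by auto
    show ?case
    proof
      fix g assume g: "g \<in> carrier G"
      have "R g (g \<otimes> h \<otimes> k)" using eng g hk by (meson m_closed trans)
      then show "R g (g \<otimes> (h \<otimes> k))" using g hk by (simp add: m_assoc)
    qed
  qed
  then have "R g (g \<otimes> (inv g \<otimes> h))" using assms generators by simp
  then show ?thesis using assms by (simp add: R_def flip: m_assoc)
qed

text \<open>
  The height of \<open>g\<close> is the difference of the times at which the paths from \<open>\<one>\<close> and from \<open>g\<close> meet.  It
  does not depend on the meeting point because the flow has no cycles.
\<close>
lemma height_exists:
  obtains ht :: "'g \<Rightarrow> int"
  where "\<And>g. g \<in> carrier G \<Longrightarrow> ht (g \<otimes> b) = ht g"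
    and "\<And>g. g \<in> carrier G \<Longrightarrow> E g \<Longrightarrow> ht (g \<otimes> a) = ht g + 1"
proof -
  have "\<forall>g. \<exists>p. g \<in> carrier G \<longrightarrow> (flow ^^ fst p) g = (flow ^^ snd p) \<one>"
    using flow_merges by fastforce
  then obtain p where p: "\<And>g. g \<in> carrier G \<Longrightarrow> (flow ^^ fst (p g)) g = (flow ^^ snd (p g)) \<one>"
    by metis
  \<comment> \<open>Any choice of meeting times gives the same difference, by \<open>ht\<close> below.\<close>
  define ht where "ht g = int (snd (p g)) - int (fst (p g))" for g
  have ht: "ht g = int j - int i" if g: "g \<in> carrier G" and ij: "(flow ^^ i) g = (flow ^^ j) \<one>" for g i j
  proof -
    obtain i' j' where p': "p g = (i', j')" by (cases "p g")
    have "(flow ^^ (i' + j)) \<one> = (flow ^^ (i' + i)) g" by (simp add: funpow_add ij)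
    also have "\<dots> = (flow ^^ (i + i')) g" by (simp add: add.commute)
    also have "\<dots> = (flow ^^ (i + j')) \<one>" using p[OF g] p' by (simp add: funpow_add)
    finally have "i' + j = i + j'" by (rule flow_funpow_inj[OF one_closed])
    then show ?thesis by (simp add: ht_def p')
  qed
  have ht_flow: "ht (flow g) = ht g + 1" if g: "g \<in> carrier G" for g
  proof -
    obtain i j where ij: "(flow ^^ i) g = (flow ^^ j) \<one>" using flow_merges[OF g one_closed] by auto
    have "(flow ^^ i) (flow g) = (flow ^^ Suc j) \<one>"
      using ij by (metis funpow.simps(2) funpow_swap1 o_apply)
    from ht[OF _ this] ht[OF g ij] g show ?thesis by simp
  qed
  show thesis
  proof
    fix g assume g: "g \<in> carrier G"
    show "ht (g \<otimes> b) = ht g"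
      using ht_flow[OF g] ht_flow[of "g \<otimes> b"] g by (simp add: flow_b)
    show "ht (g \<otimes> a) = ht g + 1" if "E g"
      using ht_flow[OF g] that by (simp add: flow_gate)
  qed
qed

text \<open>
  If one step of the flow multiplies a quantity by \<open>2/3\<close> or \<open>2\<close> up to a bounded error, then \<open>k\<close> steps
  multiply it by \<open>2\<^sup>k 3\<^sup>j / 3\<^sup>k\<close> up to a bounded error.  The bound is a multiple of \<open>B\<close>, so that the case
  \<open>B = 0\<close> gives exact equality.  The exponent \<open>j\<close> is the same for all \<open>N\<close>.
\<close>
lemma transport_along_flow:
  fixes \<sigma> :: "nat \<Rightarrow> 'g \<Rightarrow> int"
  assumes \<sigma>_b: "\<And>g N. g \<in> carrier G \<Longrightarrow> N \<in> T \<Longrightarrow> \<sigma> N (g \<otimes> b) = \<sigma> N g"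
    and step: "\<And>g. g \<in> carrier G \<Longrightarrow> E g \<Longrightarrow>
      \<exists>\<kappa>\<in>{2, 6}. \<forall>N\<in>T. \<bar>\<kappa> * \<sigma> N g - 3 * \<sigma> N (g \<otimes> a)\<bar> \<le> B"
    and g: "g \<in> carrier G"
  shows "\<exists>j C. \<forall>N\<in>T. \<bar>2 ^ k * 3 ^ j * \<sigma> N g - 3 ^ k * \<sigma> N ((flow ^^ k) g)\<bar> \<le> C * B"
proof (induction k)
  case 0
  show ?case by (intro exI[of _ 0]) simp
next
  case (Suc k)
  then obtain j C where IH: "\<forall>N\<in>T. \<bar>2 ^ k * 3 ^ j * \<sigma> N g - 3 ^ k * \<sigma> N ((flow ^^ k) g)\<bar> \<le> C * B"
    by blast
  define u where "u = (flow ^^ k) g"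
  have u: "u \<in> carrier G" using g by (simp add: u_def)
  have gate: "\<sigma> N (gate u) = \<sigma> N u" if "N \<in> T" for N
    using u that by (simp add: gate_def \<sigma>_b)
  obtain \<kappa> where \<kappa>: "\<kappa> \<in> {2, 6}" "\<forall>N\<in>T. \<bar>\<kappa> * \<sigma> N u - 3 * \<sigma> N (flow u)\<bar> \<le> B"
    using step[of "gate u"] u gate by (auto simp: E_gate flow_def)
  obtain i where i: "\<kappa> = 2 * 3 ^ i"
  proof (cases "\<kappa> = 2")
    case True then show ?thesis using that[of 0] by simp
  next
    case False then show ?thesis using \<kappa> that[of 1] by simp
  qed
  have "\<bar>2 ^ Suc k * 3 ^ (i + j) * \<sigma> N g - 3 ^ Suc k * \<sigma> N ((flow ^^ Suc k) g)\<bar> \<le> (\<kappa> * C + 3 ^ k) * B"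
    if "N \<in> T" for N
  proof -
    let ?x = "2 ^ k * 3 ^ j * \<sigma> N g - 3 ^ k * \<sigma> N u" and ?y = "\<kappa> * \<sigma> N u - 3 * \<sigma> N (flow u)"
    have "2 ^ Suc k * 3 ^ (i + j) * \<sigma> N g - 3 ^ Suc k * \<sigma> N ((flow ^^ Suc k) g) = \<kappa> * ?x + 3 ^ k * ?y"
      by (simp add: i u_def algebra_simps power_add)
    also have "\<bar>\<dots>\<bar> \<le> \<bar>\<kappa> * ?x\<bar> + \<bar>3 ^ k * ?y\<bar>" by (rule abs_triangle_ineq)
    also have "\<dots> = \<kappa> * \<bar>?x\<bar> + 3 ^ k * \<bar>?y\<bar>" using \<kappa>(1) by (auto simp: abs_mult)
    also have "\<dots> \<le> \<kappa> * (C * B) + 3 ^ k * B"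
      using \<kappa> IH that by (intro add_mono mult_left_mono) (auto simp: u_def)
    finally show ?thesis by (simp add: algebra_simps)
  qed
  then show ?case by blast
qed

end

section \<open>Subshifts of finite type\<close>

text \<open>
  A rule that reads finitely many cells with finitely many possible symbols forbids finitely many
  patterns.  The rule is imposed at \<open>g\<close> and not at \<open>g\<inverse>\<close>, which makes no difference as \<open>g\<close> ranges over the
  whole group.
\<close>
lemma SFT_of_local_rule:
  assumes "group H" "finite A" and D: "finite D" "D \<subseteq> carrier H"
    and determined: "\<And>y z. (\<And>d. d \<in> D \<Longrightarrow> y d = z d) \<Longrightarrow> \<Phi> y \<longleftrightarrow> \<Phi> z"
  shows "is_SFT H A {x \<in> full_shift H A. \<forall>g\<in>carrier H. \<Phi> (\<lambda>d. x (g \<otimes>\<^bsub>H\<^esub> d))}"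
proof -
  interpret H: group H by fact
  define L where "L = Pair D ` {w \<in> D \<rightarrow>\<^sub>E A. \<not> \<Phi> w}"
  have "finite L"
    unfolding L_def using D(1) \<open>finite A\<close>
    by (intro finite_imageI finite_subset[OF _ finite_PiE[of D "\<lambda>_. A"]]) auto
  have "L \<subseteq> patterns H A"
    using D by (auto simp: L_def patterns_def)
  have allowed: "(\<forall>(D, w)\<in>L. restrict (shift H g x) D \<noteq> w) \<longleftrightarrow> \<Phi> (\<lambda>d. x (inv\<^bsub>H\<^esub> g \<otimes>\<^bsub>H\<^esub> d))"
    if x: "x \<in> full_shift H A" and g: "g \<in> carrier H" for x g
  proof -
    have "x (inv\<^bsub>H\<^esub> g \<otimes>\<^bsub>H\<^esub> d) \<in> A" if "d \<in> D" for d
      using x D(2) g that unfolding full_shift_def by (intro PiE_mem[of x "carrier H" "\<lambda>_. A"]) auto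
    then have "restrict (shift H g x) D \<in> D \<rightarrow>\<^sub>E A"
      using D(2) by (auto simp: shift_def subset_iff)
    moreover have "(\<forall>(D', w)\<in>L. restrict y D' \<noteq> w) \<longleftrightarrow> \<Phi> (restrict y D)"
      if "restrict y D \<in> D \<rightarrow>\<^sub>E A" for y
      using that unfolding L_def by blast
    ultimately have "(\<forall>(D, w)\<in>L. restrict (shift H g x) D \<noteq> w) \<longleftrightarrow> \<Phi> (restrict (shift H g x) D)"
      by blast
    also have "\<dots> \<longleftrightarrow> \<Phi> (\<lambda>d. x (inv\<^bsub>H\<^esub> g \<otimes>\<^bsub>H\<^esub> d))"
      using D by (intro determined) (auto simp: shift_def)
    finally show ?thesis .
  qed
  have reindex: "(\<forall>g\<in>carrier H. \<Phi> (\<lambda>d. x (inv\<^bsub>H\<^esub> g \<otimes>\<^bsub>H\<^esub> d))) \<longleftrightarrow>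
      (\<forall>g\<in>carrier H. \<Phi> (\<lambda>d. x (g \<otimes>\<^bsub>H\<^esub> d)))" for x
    by (metis H.inv_closed H.inv_inv)
  have "{x \<in> full_shift H A. \<forall>g\<in>carrier H. \<Phi> (\<lambda>d. x (g \<otimes>\<^bsub>H\<^esub> d))} =
      {x \<in> full_shift H A. \<forall>g\<in>carrier H. \<forall>(D, w)\<in>L. restrict (shift H g x) D \<noteq> w}"
    by (rule Collect_cong, rule conj_cong[OF refl], subst reindex[symmetric], rule ball_cong[OF refl],
        rule allowed[symmetric])
  with \<open>finite L\<close> \<open>L \<subseteq> patterns H A\<close> show ?thesis
    unfolding is_SFT_def by blast
qed

lemma finitely_generated_integer_group_times:
  assumes "group G" "finite S" "S \<subseteq> carrier G" "generate G S = carrier G"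
  shows "finitely_generated_group (integer_group \<times>\<times> G)"
proof -
  interpret G: group G by fact
  interpret H: group "integer_group \<times>\<times> G" by (intro DirProd_group group_integer_group G.is_group)
  define U where "U = insert (1::int, \<one>\<^bsub>G\<^esub>) (Pair 0 ` S)"
  let ?gen = "generate (integer_group \<times>\<times> G) U"
  have UH: "U \<subseteq> carrier (integer_group \<times>\<times> G)" using assms by (auto simp: U_def)
  have 1: "(0, g) \<in> ?gen" if "g \<in> generate G S" for g
    using that
  proof (induction rule: generate.induct)
    case one
    then show ?case using generate.one[of "integer_group \<times>\<times> G" U] by simp
  next
    case (incl h)
    then show ?case by (auto simp: U_def intro: generate.incl)
  next
    case (inv h)
    then have "inv\<^bsub>integer_group \<times>\<times> G\<^esub> (0, h) \<in> ?gen" by (auto simp: U_def intro: generate.inv)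
    then show ?case using inv assms by (auto simp: inv_DirProd)
  next
    case (eng h k)
    then show ?case using generate.eng[OF eng(3,4)] by simp
  qed
  have up: "(n + 1, \<one>\<^bsub>G\<^esub>) \<in> ?gen" if "(n, \<one>\<^bsub>G\<^esub>) \<in> ?gen" for n
    using generate.eng[OF that generate.incl[of "(1, \<one>\<^bsub>G\<^esub>)" U]] by (simp add: U_def)
  have down: "(n - 1, \<one>\<^bsub>G\<^esub>) \<in> ?gen" if "(n, \<one>\<^bsub>G\<^esub>) \<in> ?gen" for n
    using generate.eng[OF that generate.inv[of "(1, \<one>\<^bsub>G\<^esub>)" U]] by (simp add: U_def inv_DirProd)
  have 2: "(n, \<one>\<^bsub>G\<^esub>) \<in> ?gen" for n
    by (induction n rule: int_induct[of _ 0]) (auto intro: up down 1 generate.one)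
  have "(n, g) \<in> ?gen" if "g \<in> carrier G" for n g
    using generate.eng[OF 2[of n] 1[of g]] that assms by simp
  then have "?gen = carrier (integer_group \<times>\<times> G)"
    using H.generate_in_carrier[OF UH] by auto
  then show ?thesis
    unfolding finitely_generated_group_def using UH assms by (auto intro!: exI[of _ U] H.is_group simp: U_def)
qed

section \<open>Rows multiplied by two or two thirds\<close>

text \<open>
  On the logarithmic scale modulo \<open>log 3\<close>, multiplication by \<open>2\<close> is the rotation by \<open>log\<^sub>3 2\<close>.
\<close>
lemma bi_infinite_orbit:
  obtains t :: "int \<Rightarrow> real"
  where "\<And>k. 1 \<le> t k \<and> t k < 3" and "\<And>k. t (k + 1) = 2 * t k \<or> t (k + 1) = 2 / 3 * t k"
proof
  define z where "z k = real_of_int k * log 3 2" for k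
  define t where "t k = 3 powr frac (z k)" for k
  show "1 \<le> t k \<and> t k < 3" for k
    using frac_lt_1[of "z k"] frac_ge_0[of "z k"] powr_less_mono[of "frac (z k)" 1 3]
    by (auto simp: t_def ge_one_powr_ge_zero)
  have l: "0 < log 3 (2::real)" "log 3 (2::real) < 1" "3 powr log 3 2 = (2::real)" by auto
  show "t (k + 1) = 2 * t k \<or> t (k + 1) = 2 / 3 * t k" for k
  proof -
    have f: "frac (log 3 (2::real)) = log 3 2" using l by (simp add: frac_eq)
    have "frac (z (k + 1)) = frac (z k) + log 3 2 \<or> frac (z (k + 1)) = frac (z k) + log 3 2 - 1"
      using frac_add[of "z k" "log 3 2"] f by (auto simp: z_def algebra_simps)
    then show ?thesis using l(3) by (auto simp: t_def powr_add powr_diff)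
  qed
qed

lemma int_step_constant:
  fixes f :: "int \<Rightarrow> 'a"
  assumes "\<And>n. f (n + 1) = f n"
  shows "f n = f 0"
  by (induction n rule: int_induct[of _ 0]) (use assms assms[of "_ - 1"] in auto)

text \<open>
  Shifting the window by one position exchanges only its two boundary values.
\<close>
lemma window_sum_shift_bounded:
  fixes f :: "int \<Rightarrow> int"
  assumes f: "\<And>n. f n \<in> {1..3}"
  shows "\<exists>C. \<forall>N. \<bar>(\<Sum>i<N. f (int i + m)) - (\<Sum>i<N. f (int i))\<bar> \<le> C"
proof -
  define s where "s m N = (\<Sum>i<N. f (int i + m))" for m N
  have step: "\<bar>s (m + 1) N - s m N\<bar> \<le> 2" for m N
  proof -
    have "s (m + 1) N - s m N = (\<Sum>i<N. f (int (Suc i) + m) - f (int i + m))"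
      by (simp add: s_def sum_subtractf algebra_simps)
    also have "\<dots> = f (int N + m) - f m"
      by (subst sum_lessThan_telescope) simp
    finally show ?thesis using f[of "int N + m"] f[of m] by auto
  qed
  have "\<exists>C. \<forall>N. \<bar>s m N - s 0 N\<bar> \<le> C"
  proof (induction m rule: int_induct[of _ 0])
    case base
    show ?case by auto
  next
    case (step1 m)
    then obtain C where C: "\<bar>s m N - s 0 N\<bar> \<le> C" for N by blast
    have "\<bar>s (m + 1) N - s 0 N\<bar> \<le> C + 2" for N
      using step[of m N] C[of N] by linarith
    then show ?case by blast
  next
    case (step2 m)
    then obtain C where C: "\<bar>s m N - s 0 N\<bar> \<le> C" for N by blast
    have "\<bar>s (m - 1) N - s 0 N\<bar> \<le> C + 2" for N
    proof -
      have "\<bar>s m N - s (m - 1) N\<bar> \<le> 2" using step[of "m - 1" N] by simp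
      then show ?thesis using C[of N] by linarith
    qed
    then show ?case by blast
  qed
  then show ?thesis by (simp add: s_def)
qed

text \<open>
  A symbol says whether its cell is an exit, and contains the multiplier, the digit of the row, and
  the carry.  The multiplier is stored as three times the factor \<open>2/3\<close> or \<open>2\<close> to keep all
  entries integral.
\<close>
type_synonym symbol = "bool \<times> int \<times> int \<times> int"

abbreviation is_gate :: "symbol \<Rightarrow> bool" where "is_gate s \<equiv> fst s"
abbreviation factor :: "symbol \<Rightarrow> int" where "factor s \<equiv> fst (snd s)"
abbreviation digit :: "symbol \<Rightarrow> int" where "digit s \<equiv> fst (snd (snd s))"
abbreviation carry :: "symbol \<Rightarrow> int" where "carry s \<equiv> snd (snd (snd s))"

text \<open>
  A carry \<open>\<kappa>\<lfloor>x\<rfloor> - 3\<lfloor>y\<rfloor>\<close> with \<open>\<kappa>x = 3y\<close> and \<open>0 < \<kappa> \<le> 6\<close> lies strictly between \<open>-6\<close> and \<open>3\<close>.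
\<close>
definition symbols :: "symbol set"
  where "symbols = UNIV \<times> {2, 6} \<times> {1..3} \<times> {-6..3}"

lemma finite_symbols: "finite symbols"
  by (simp add: symbols_def)

context modular_generators
begin

text \<open>
  The first four conditions say that the exits form a flow that is independent of the integer
  coordinate, and the fifth that the digits are common to a triangle.  By the last one,
  the differences of carries telescope along a row, so that the sums of digits on the two sides
  of an exit are related by the multiplier up to a bounded error.
\<close>
definition cell_rule :: "(int \<times> 'g \<Rightarrow> symbol) \<Rightarrow> int \<Rightarrow> 'g \<Rightarrow> bool"
  where "cell_rule x n g \<longleftrightarrow>
    (is_gate (x (n + 1, g)) \<longleftrightarrow> is_gate (x (n, g))) \<and>
    (is_gate (x (n, g \<otimes> a)) \<longleftrightarrow> \<not> is_gate (x (n, g))) \<and>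
    (is_gate (x (n, g)) \<or> is_gate (x (n, g \<otimes> b)) \<or> is_gate (x (n, g \<otimes> b \<otimes> b))) \<and>
    (is_gate (x (n, g)) \<longrightarrow> \<not> is_gate (x (n, g \<otimes> b))) \<and>
    digit (x (n, g \<otimes> b)) = digit (x (n, g)) \<and>
    (is_gate (x (n, g)) \<longrightarrow>
      factor (x (n + 1, g)) = factor (x (n, g)) \<and>
      factor (x (n, g)) * digit (x (n, g)) + carry (x (n, g)) =
        3 * digit (x (n, g \<otimes> a)) + carry (x (n + 1, g)))"

text \<open>
  For \<open>h \<noteq> \<one>\<close>, the row sums of some \<open>u\<close> stay at bounded distance from those of the element reached from \<open>u\<close>
  after \<open>d > 0\<close> steps of the flow, although they differ by a factor \<open>2\<^sup>d 3\<^sup>j / 3\<^sup>d \<noteq> 1\<close> and grow linearly.  For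
  \<open>h = \<one>\<close> and \<open>m \<noteq> 0\<close>, the carries cancel over a period, and the sum over a period is multiplied
  exactly.
\<close>
lemma tableau_aperiodic:
  assumes rule: "\<And>n g. g \<in> carrier G \<Longrightarrow> cell_rule x n g"
    and sym: "\<And>n g. g \<in> carrier G \<Longrightarrow> x (n, g) \<in> symbols"
    and h: "h \<in> carrier G"
    and period: "\<And>n g. g \<in> carrier G \<Longrightarrow> x (m + n, h \<otimes> g) = x (n, g)"
  shows "m = 0 \<and> h = \<one>"
proof -
  define E where "E g = is_gate (x (0, g))" for g
  have E: "is_gate (x (n, g)) \<longleftrightarrow> E g" if "g \<in> carrier G" for n g
    unfolding E_def by (rule int_step_constant) (use rule[OF that] in \<open>auto simp: cell_rule_def\<close>)
  interpret modular_flow G a b E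
  proof
    fix g assume g: "g \<in> carrier G"
    show "E (g \<otimes> a) \<longleftrightarrow> \<not> E g" "E g \<or> E (g \<otimes> b) \<or> E (g \<otimes> b \<otimes> b)" "E g \<Longrightarrow> \<not> E (g \<otimes> b)"
      using rule[OF g, of 0] unfolding cell_rule_def E_def by auto
  qed
  define \<sigma> where "\<sigma> N g = (\<Sum>i<N. digit (x (int i, g)))" for N g
  have digit_range: "digit (x (n, g)) \<in> {1..3}" and carry_range: "carry (x (n, g)) \<in> {-6..3}"
    and factor_range: "factor (x (n, g)) \<in> {2, 6}" if "g \<in> carrier G" for n g
    using sym[OF that, of n] by (auto simp: symbols_def)
  have \<sigma>_b: "\<sigma> N (g \<otimes> b) = \<sigma> N g" if "g \<in> carrier G" for N g
    using rule[OF that] by (simp add: \<sigma>_def cell_rule_def)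
  have \<sigma>_step: "factor (x (0, g)) * \<sigma> N g + carry (x (0, g)) = 3 * \<sigma> N (g \<otimes> a) + carry (x (int N, g))"
    if g: "g \<in> carrier G" and "E g" for N g
  proof -
    have gate: "is_gate (x (n, g))" for n using E g \<open>E g\<close> by simp
    have f: "factor (x (n, g)) = factor (x (0, g))" for n
      by (rule int_step_constant) (use rule[OF g] gate in \<open>auto simp: cell_rule_def\<close>)
    show ?thesis
    proof (induction N)
      case 0
      then show ?case by (simp add: \<sigma>_def)
    next
      case (Suc N)
      have "factor (x (0, g)) * digit (x (int N, g)) + carry (x (int N, g)) =
          3 * digit (x (int N, g \<otimes> a)) + carry (x (int N + 1, g))"
        using rule[OF g, of "int N"] gate f[of "int N"] by (auto simp: cell_rule_def)
      then show ?case using Suc by (simp add: \<sigma>_def algebra_simps)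
    qed
  qed
  have \<sigma>_ge: "int N \<le> \<sigma> N g" and \<sigma>_le: "\<sigma> N g \<le> 3 * int N" if g: "g \<in> carrier G" for N g
    using sum_bounded_below[of "{..<N}" 1 "\<lambda>i. digit (x (int i, g))"]
      sum_bounded_above[of "{..<N}" "\<lambda>i. digit (x (int i, g))" 3] digit_range[OF g]
    by (auto simp: \<sigma>_def)

  have "h = \<one>"
  proof (rule ccontr)
    assume "h \<noteq> \<one>"
    have E_h: "E (h \<otimes> g) \<longleftrightarrow> E g" if "g \<in> carrier G" for g
      using E[of "h \<otimes> g" "m + 0"] period[OF that, of 0] that h by (simp add: E_def)
    have flow_h: "flow (h \<otimes> g) = h \<otimes> flow g" if "g \<in> carrier G" for g
      using that h E_h[of g] E_h[of "g \<otimes> b"] by (simp add: flow_def gate_def m_assoc)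
    have funpow_h: "(flow ^^ k) (h \<otimes> g) = h \<otimes> (flow ^^ k) g" if "g \<in> carrier G" for k g
      by (induction k) (use that in \<open>auto simp: flow_h\<close>)
    \<comment> \<open>The flow commutes with \<open>h\<close>, so the paths from \<open>\<one>\<close> and \<open>h\<close> are translates of each other that merge.
      They do so after different times, as otherwise \<open>h\<close> would fix an element.\<close>
    obtain i j where ij: "(flow ^^ i) \<one> = h \<otimes> (flow ^^ j) \<one>"
      using flow_merges[OF one_closed h] funpow_h[OF one_closed] h by auto
    have "i \<noteq> j"
      using ij \<open>h \<noteq> \<one>\<close> h by (auto simp: l_cancel_one)
    obtain d u where "d > 0" and u: "u \<in> carrier G"
      and du: "(flow ^^ d) u = h \<otimes> u \<or> u = h \<otimes> (flow ^^ d) u"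
    proof (cases "i < j")
      case True
      then have "(flow ^^ j) \<one> = (flow ^^ (j - i)) ((flow ^^ i) \<one>)"
        by (metis add.commute add_diff_inverse_nat funpow_add less_imp_not_less o_apply)
      then show ?thesis using that[of "j - i" "(flow ^^ i) \<one>"] ij True
        by (metis flow_funpow_closed one_closed zero_less_diff)
    next
      case False
      then have "(flow ^^ i) \<one> = (flow ^^ (i - j)) ((flow ^^ j) \<one>)"
        by (metis add.commute add_diff_inverse_nat funpow_add o_apply)
      then show ?thesis using that[of "i - j" "(flow ^^ j) \<one>"] ij False \<open>i \<noteq> j\<close>
        by (metis flow_funpow_closed one_closed zero_less_diff linorder_neqE_nat)
    qed
    have \<sigma>_h: "\<exists>C. \<forall>N. \<bar>\<sigma> N (h \<otimes> g) - \<sigma> N g\<bar> \<le> C" if g: "g \<in> carrier G" for g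
    proof -
      have "\<sigma> N (h \<otimes> g) = (\<Sum>i<N. digit (x (int i + - m, g)))" for N
        using period[OF g, of "int _ - m"] by (simp add: \<sigma>_def)
      then show ?thesis
        using window_sum_shift_bounded[of "\<lambda>n. digit (x (n, g))" "- m"] digit_range[OF g]
        by (simp add: \<sigma>_def)
    qed
    define v where "v = (flow ^^ d) u"
    have v: "v \<in> carrier G" using u by (simp add: v_def)
    obtain C where C: "\<bar>\<sigma> N v - \<sigma> N u\<bar> \<le> C" for N
      using du \<sigma>_h[OF u] \<sigma>_h[OF v] unfolding v_def[symmetric] by (metis abs_minus_commute)
    have "\<exists>\<kappa>\<in>{2, 6}. \<forall>N\<in>UNIV. \<bar>\<kappa> * \<sigma> N g - 3 * \<sigma> N (g \<otimes> a)\<bar> \<le> 9"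
      if g: "g \<in> carrier G" and Eg: "E g" for g
    proof (intro bexI[OF _ factor_range[OF g, of 0]] ballI)
      fix N
      show "\<bar>factor (x (0, g)) * \<sigma> N g - 3 * \<sigma> N (g \<otimes> a)\<bar> \<le> 9"
        using \<sigma>_step[OF g Eg, of N] carry_range[OF g, of 0] carry_range[OF g, of "int N"] by auto
    qed
    from transport_along_flow[of UNIV \<sigma>, OF \<sigma>_b this u, of d]
    obtain j' C' where C': "\<bar>2 ^ d * 3 ^ j' * \<sigma> N u - 3 ^ d * \<sigma> N v\<bar> \<le> C' * 9" for N
      by (auto simp: v_def)
    define q where "q = (2 ^ d * 3 ^ j' - 3 ^ d :: int)"
    \<comment> \<open>Since \<open>d > 0\<close>, parity keeps the total factor away from one.\<close>
    have "even (2 ^ d * 3 ^ j' :: int)" "odd (3 ^ d :: int)" using \<open>d > 0\<close> by auto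
    then have "q \<noteq> 0" unfolding q_def by (metis eq_iff_diff_eq_0)
    define K where "K = C' * 9 + 3 ^ d * C"
    have bound: "\<bar>q * \<sigma> N u\<bar> \<le> K" for N
    proof -
      have "q * \<sigma> N u = (2 ^ d * 3 ^ j' * \<sigma> N u - 3 ^ d * \<sigma> N v) + 3 ^ d * (\<sigma> N v - \<sigma> N u)"
        by (simp add: q_def algebra_simps)
      also have "\<bar>\<dots>\<bar> \<le> \<bar>2 ^ d * 3 ^ j' * \<sigma> N u - 3 ^ d * \<sigma> N v\<bar> + \<bar>3 ^ d * (\<sigma> N v - \<sigma> N u)\<bar>"
        by (rule abs_triangle_ineq)
      also have "\<dots> \<le> K"
        unfolding K_def using C'[of N] C[of N] by (intro add_mono) (auto simp: abs_mult)
      finally show ?thesis .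
    qed
    define N where "N = nat (K + 1)"
    have "K + 1 \<le> int N" by (simp add: N_def)
    also have "\<dots> \<le> \<sigma> N u" by (rule \<sigma>_ge[OF u])
    also have "\<dots> \<le> \<bar>\<sigma> N u\<bar>" by simp
    also have "\<dots> \<le> \<bar>q\<bar> * \<bar>\<sigma> N u\<bar>" using \<open>q \<noteq> 0\<close>
      by (intro mult_right_le_one_le[THEN order_trans] mult_le_cancel_right1[THEN iffD2]) auto
    also have "\<dots> \<le> K" using bound by (simp add: abs_mult)
    finally show False by simp
  qed

  moreover have "m = 0" if "h = \<one>"
  proof (rule ccontr)
    assume "m \<noteq> 0"
    define M where "M = nat \<bar>m\<bar>"
    have "M > 0" using \<open>m \<noteq> 0\<close> by (simp add: M_def)
    have per: "x (int M, g) = x (0, g)" if g: "g \<in> carrier G" for g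
      using period[OF g, of 0] period[OF g, of "- m"] g \<open>h = \<one>\<close> by (cases "m > 0") (auto simp: M_def)
    have "\<exists>\<kappa>\<in>{2, 6}. \<forall>N\<in>{M}. \<bar>\<kappa> * \<sigma> N g - 3 * \<sigma> N (g \<otimes> a)\<bar> \<le> 0"
      if g: "g \<in> carrier G" and Eg: "E g" for g
      by (rule bexI[OF _ factor_range[OF g, of 0]]) (use \<sigma>_step[OF g Eg, of M] per[OF g] in auto)
    from transport_along_flow[of "{M}" \<sigma>, OF \<sigma>_b this one_closed, of "3 * M"]
    obtain j where j: "2 ^ (3 * M) * 3 ^ j * \<sigma> M \<one> = 3 ^ (3 * M) * \<sigma> M ((flow ^^ (3 * M)) \<one>)"
      by auto
    define s where "s = \<sigma> M ((flow ^^ (3 * M)) \<one>)"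
    \<comment> \<open>The number \<open>3M\<close> of steps makes the power of two exceed the largest possible sum \<open>3M\<close> of a period.\<close>
    have "2 ^ (3 * M) dvd 3 ^ (3 * M) * s"
      using j by (metis dvd_def mult.assoc s_def)
    then have "2 ^ (3 * M) dvd s"
      by (subst (asm) coprime_dvd_mult_right_iff) auto
    moreover have "int M \<le> s" "s \<le> 3 * int M" unfolding s_def using \<sigma>_ge \<sigma>_le by auto
    ultimately have "2 ^ (3 * M) \<le> 3 * int M"
      using \<open>M > 0\<close> by (smt (verit) of_nat_0_less_iff zdvd_imp_le)
    moreover have "int (3 * M) < int (2 ^ (3 * M))" by (simp only: of_nat_less_iff less_exp)
    ultimately show False by simp
  qed
  ultimately show ?thesis by simp
qed

end

context modular_flow
begin

text \<open>
  The row of \<open>g\<close> is the Beatty sequence of the point \<open>t\<close> of the orbit whose index is the height of \<open>g\<close>.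
  With \<open>\<kappa>t = 3t'\<close>, the carry \<open>\<kappa>\<lfloor>nt\<rfloor> - 3\<lfloor>nt'\<rfloor>\<close> is the accumulated rounding error.
\<close>
lemma tableau_exists:
  obtains x where "\<And>n g. g \<in> carrier G \<Longrightarrow> cell_rule x n g" and "\<And>n g. x (n, g) \<in> symbols"
proof -
  obtain ht :: "'g \<Rightarrow> int" where ht_b: "\<And>g. g \<in> carrier G \<Longrightarrow> ht (g \<otimes> b) = ht g"
    and ht_a: "\<And>g. g \<in> carrier G \<Longrightarrow> E g \<Longrightarrow> ht (g \<otimes> a) = ht g + 1"
    by (rule height_exists) blast
  obtain t :: "int \<Rightarrow> real" where t: "\<And>k. 1 \<le> t k \<and> t k < 3"
    and t_step: "\<And>k. t (k + 1) = 2 * t k \<or> t (k + 1) = 2 / 3 * t k"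
    by (rule bi_infinite_orbit) blast
  define \<kappa> :: "int \<Rightarrow> int" where "\<kappa> k = (if t (k + 1) = 2 * t k then 6 else 2)" for k
  have \<kappa>: "real_of_int (\<kappa> k) * t k = 3 * t (k + 1)" "\<kappa> k \<in> {2, 6}" for k
    using t_step[of k] by (auto simp: \<kappa>_def)
  define f where "f n k = \<lfloor>real_of_int n * t k\<rfloor>" for n k
  define x where "x = (\<lambda>(n, g). (E g, \<kappa> (ht g), f (n + 1) (ht g) - f n (ht g),
    \<kappa> (ht g) * f n (ht g) - 3 * f n (ht g + 1)))"
  have digit_range: "f (n + 1) k - f n k \<in> {1..3}" for n k
  proof -
    have floor_diff: "\<lfloor>X + T\<rfloor> - \<lfloor>X\<rfloor> \<in> {1..3}" if "1 \<le> T \<and> T < 3" for X T :: real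
      using that by (simp; linarith)
    have "real_of_int (n + 1) * t k = real_of_int n * t k + t k" by (simp add: algebra_simps)
    then show ?thesis using floor_diff[OF t[of k], of "real_of_int n * t k"] by (simp only: f_def)
  qed
  have carry_range: "\<kappa> k * f n k - 3 * f n (k + 1) \<in> {-6..3}" for n k
  proof -
    have carry: "c * \<lfloor>X\<rfloor> - 3 * \<lfloor>Y\<rfloor> \<in> {-6..3}" if "real_of_int c * X = 3 * Y" "c \<in> {2, 6}" for c X Y
      using that by (auto; linarith)
    have "real_of_int (\<kappa> k) * (real_of_int n * t k) = 3 * (real_of_int n * t (k + 1))"
      using \<kappa>(1)[of k] by (metis mult.left_commute)
    from carry[OF this \<kappa>(2)] show ?thesis unfolding f_def .
  qed
  show thesis
  proof
    show "x (n, g) \<in> symbols" for n g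
      using digit_range carry_range \<kappa>(2) by (auto simp: x_def symbols_def)
    show "cell_rule x n g" if g: "g \<in> carrier G" for n g
      using g E_a[OF g] E_covers[OF g] E_disjoint[OF g] ht_a[OF g] ht_b[OF g]
      by (auto simp: cell_rule_def x_def algebra_simps)
  qed
qed

text \<open>
  The stabilizers are trivial and not only finite, because \<open>tableau_aperiodic\<close> applies to the
  translation by any element of a stabilizer.
\<close>
theorem integers_times_modular_admits_SFT: "admits_strongly_aperiodic_SFT (integer_group \<times>\<times> G)"
proof -
  let ?H = "integer_group \<times>\<times> G"
  interpret H: group ?H by (intro DirProd_group group_integer_group is_group)
  define A where "A = to_nat ` symbols"
  define \<Phi> where "\<Phi> y = cell_rule (\<lambda>z. from_nat (y z)) 0 \<one>" for y :: "int \<times> 'g \<Rightarrow> nat"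
  define X where "X = {x \<in> full_shift ?H A. \<forall>z\<in>carrier ?H. \<Phi> (\<lambda>d. x (z \<otimes>\<^bsub>?H\<^esub> d))}"
  have \<Phi>: "\<Phi> (\<lambda>d. x ((n, g) \<otimes>\<^bsub>?H\<^esub> d)) \<longleftrightarrow> cell_rule (\<lambda>z. from_nat (x z)) n g" if "g \<in> carrier G" for x n g
    using that by (simp add: \<Phi>_def cell_rule_def m_assoc)
  have "finite A" by (simp add: A_def finite_symbols)
  have "is_SFT ?H A X"
    unfolding X_def
  proof (rule SFT_of_local_rule)
    show "group ?H" by (rule H.is_group)
    show "finite A" by fact
    show "finite {(0, \<one>), (1, \<one>), (0, a), (0, b), (0, b \<otimes> b)}" by simp
    show "{(0, \<one>), (1, \<one>), (0, a), (0, b), (0, b \<otimes> b)} \<subseteq> carrier ?H" by simp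
    show "\<Phi> y \<longleftrightarrow> \<Phi> z" if "\<And>d. d \<in> {(0, \<one>), (1, \<one>), (0, a), (0, b), (0, b \<otimes> b)} \<Longrightarrow> y d = z d" for y z
      using that by (simp add: \<Phi>_def cell_rule_def)
  qed
  moreover have "X \<noteq> {}"
  proof -
    obtain x where x: "\<And>n g. g \<in> carrier G \<Longrightarrow> cell_rule x n g" "\<And>n g. x (n, g) \<in> symbols"
      by (rule tableau_exists) blast
    define y where "y = (\<lambda>z\<in>carrier ?H. to_nat (x z))"
    have "y \<in> full_shift ?H A"
      using x(2) by (auto simp: y_def full_shift_def A_def)
    moreover have "cell_rule (\<lambda>z. from_nat (y z)) n g" if "g \<in> carrier G" for n g
      using x(1)[OF that, of n] that by (simp add: y_def cell_rule_def)
    ultimately have "y \<in> X" using \<Phi> by (auto simp: X_def)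
    then show ?thesis by blast
  qed
  moreover have "finite (stabilizer ?H (shift ?H) x)" if "x \<in> X" for x
  proof -
    have "z = \<one>\<^bsub>?H\<^esub>" if z: "z \<in> stabilizer ?H (shift ?H) x" for z
    proof -
      obtain m h where mh: "inv\<^bsub>?H\<^esub> z = (m, h)" by fastforce
      have zH: "z \<in> carrier ?H" and fix_x: "shift ?H z x = x" using z by (auto simp: stabilizer_def)
      have h: "h \<in> carrier G" using H.inv_closed[OF zH] mh by simp
      have "m = 0 \<and> h = \<one>"
      proof (rule tableau_aperiodic)
        show "cell_rule (\<lambda>z. from_nat (x z)) n g" if "g \<in> carrier G" for n g
          using \<open>x \<in> X\<close> \<Phi>[OF that, of x n] that by (auto simp: X_def)
        show "from_nat (x (n, g)) \<in> symbols" if "g \<in> carrier G" for n g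
        proof -
          have "x (n, g) \<in> A" using \<open>x \<in> X\<close> that by (auto simp: X_def full_shift_def)
          then show ?thesis by (auto simp: A_def)
        qed
        show "from_nat (x (m + n, h \<otimes> g)) = (from_nat (x (n, g)) :: symbol)" if "g \<in> carrier G" for n g
          using fun_cong[OF fix_x, of "(n, g)"] mh that by (simp add: shift_def)
      qed (rule h)
      then show ?thesis using mh H.inv_inv[OF zH] H.inv_one by simp
    qed
    then show ?thesis by (metis finite.emptyI finite_insert finite_subset singletonI subsetI)
  qed
  moreover have "finitely_generated_group ?H"
    by (rule finitely_generated_integer_group_times[of _ "{a, b}"]) (use generators is_group in auto)
  ultimately show ?thesis
    unfolding admits_strongly_aperiodic_SFT_def strongly_aperiodic_def using \<open>finite A\<close> by blast
qed

end

section \<open>The modular group\<close>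

definition mat2 :: "int \<Rightarrow> int \<Rightarrow> int \<Rightarrow> int \<Rightarrow> int^2^2"
  where "mat2 p q r s = vector [vector [p, q], vector [r, s]]"

lemma mat2_nth [simp]:
  "mat2 p q r s $ 1 $ 1 = p" "mat2 p q r s $ 1 $ 2 = q"
  "mat2 p q r s $ 2 $ 1 = r" "mat2 p q r s $ 2 $ 2 = s"
  by (simp_all add: mat2_def)

lemma mat2_eta: "M = mat2 (M $ 1 $ 1) (M $ 1 $ 2) (M $ 2 $ 1) (M $ 2 $ 2)"
  by (simp add: vec_eq_iff forall_2)

lemma mat2_eq_iff [simp]: "mat2 p q r s = mat2 p' q' r' s' \<longleftrightarrow> p = p' \<and> q = q' \<and> r = r' \<and> s = s'"
  by (auto simp: vec_eq_iff forall_2)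

lemma mat2_mult [simp]:
  "mat2 p q r s ** mat2 p' q' r' s' =
    mat2 (p * p' + q * r') (p * q' + q * s') (r * p' + s * r') (r * q' + s * s')"
  by (simp add: vec_eq_iff forall_2 matrix_matrix_mult_def sum_2)

lemma mat2_uminus [simp]: "- mat2 p q r s = mat2 (- p) (- q) (- r) (- s)"
  by (simp add: vec_eq_iff forall_2)

lemma mat2_one: "mat 1 = mat2 1 0 0 1"
  by (simp add: vec_eq_iff forall_2 mat_def)

lemma mat2_det [simp]: "det (mat2 p q r s) = p * s - q * r"
  by (simp add: det_2)

lemma carrier_SL2Z [simp]: "M \<in> carrier SL2Z \<longleftrightarrow> det M = 1"
  and mult_SL2Z [simp]: "M \<otimes>\<^bsub>SL2Z\<^esub> N = M ** N"
  and one_SL2Z [simp]: "\<one>\<^bsub>SL2Z\<^esub> = mat 1"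
  by (simp_all add: SL2Z_def)

lemma group_SL2Z: "group SL2Z"
proof (rule groupI)
  fix M assume M: "M \<in> carrier SL2Z"
  obtain p q r s where M': "M = mat2 p q r s" using mat2_eta by blast
  have "mat2 s (- q) (- r) p \<otimes>\<^bsub>SL2Z\<^esub> M = \<one>\<^bsub>SL2Z\<^esub>" "det (mat2 s (- q) (- r) p) = 1"
    using M by (simp_all add: M' mat2_one algebra_simps)
  then show "\<exists>N\<in>carrier SL2Z. N \<otimes>\<^bsub>SL2Z\<^esub> M = \<one>\<^bsub>SL2Z\<^esub>" by (metis carrier_SL2Z)
qed (auto simp: det_mul matrix_mul_assoc)

interpretation SL2Z: group SL2Z
  by (rule group_SL2Z)

text \<open>
  The coset of a matrix modulo the centre of \<open>SL\<^sub>2(\<int>)\<close>.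
\<close>
definition pm :: "int^2^2 \<Rightarrow> (int^2^2) set"
  where "pm M = {M, - M}"

lemma minus_one_mult: "- mat 1 ** M = - (M :: int^2^2)" "M ** - mat 1 = - (M :: int^2^2)"
  by (subst (1 2) mat2_eta[of M], simp add: mat2_one)+

lemma r_coset_pm: "{mat 1, - mat 1} #>\<^bsub>SL2Z\<^esub> M = pm M"
  by (auto simp: r_coset_def pm_def minus_one_mult)

lemma normal_center: "{mat 1, - mat 1} \<lhd> SL2Z"
proof (rule SL2Z.normal_invI)
  have d: "det (- mat 1 :: int^2^2) = 1" by (simp add: mat2_one)
  show "subgroup {mat 1, - mat 1} SL2Z"
  proof
    show "inv\<^bsub>SL2Z\<^esub> x \<in> {mat 1, - mat 1}" if "x \<in> {mat 1, - mat 1}" for x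
    proof -
      have "inv\<^bsub>SL2Z\<^esub> x = x" using that d by (intro SL2Z.inv_equality) (auto simp: minus_one_mult)
      then show ?thesis using that by simp
    qed
  qed (use d in \<open>auto simp: minus_one_mult\<close>)
  fix x h assume x: "x \<in> carrier SL2Z" and h: "h \<in> {mat 1, - mat 1 :: int^2^2}"
  have "x \<otimes>\<^bsub>SL2Z\<^esub> h = h \<otimes>\<^bsub>SL2Z\<^esub> x" using h by (auto simp: minus_one_mult)
  then have "x \<otimes>\<^bsub>SL2Z\<^esub> h \<otimes>\<^bsub>SL2Z\<^esub> inv\<^bsub>SL2Z\<^esub> x = h \<otimes>\<^bsub>SL2Z\<^esub> (x \<otimes>\<^bsub>SL2Z\<^esub> inv\<^bsub>SL2Z\<^esub> x)"
    using x h d SL2Z.inv_closed[OF x] by (subst \<open>x \<otimes>\<^bsub>SL2Z\<^esub> h = h \<otimes>\<^bsub>SL2Z\<^esub> x\<close>, intro SL2Z.m_assoc) auto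
  also have "\<dots> = h" using x h d by (subst SL2Z.r_inv) auto
  finally show "x \<otimes>\<^bsub>SL2Z\<^esub> h \<otimes>\<^bsub>SL2Z\<^esub> inv\<^bsub>SL2Z\<^esub> x \<in> {mat 1, - mat 1}" using h by simp
qed

interpretation PSL2Z: group PSL2Z
  unfolding PSL2Z_def by (rule normal.factorgroup_is_group[OF normal_center])

lemma carrier_PSL2Z: "carrier PSL2Z = pm ` {M. det M = 1}"
  by (auto simp: PSL2Z_def carrier_FactGroup r_coset_pm image_iff)

lemma mult_PSL2Z: "det M = 1 \<Longrightarrow> det N = 1 \<Longrightarrow> pm M \<otimes>\<^bsub>PSL2Z\<^esub> pm N = pm (M ** N)"
  using normal.rcos_sum[OF normal_center, of M N] by (simp add: PSL2Z_def r_coset_pm)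

lemma one_PSL2Z: "\<one>\<^bsub>PSL2Z\<^esub> = pm (mat2 1 0 0 1)"
  by (simp add: PSL2Z_def pm_def mat2_one)

lemma pm_uminus: "pm (- M) = pm M"
  by (auto simp: pm_def)

lemma pm_mat2_eq_iff: "pm M = pm N \<longleftrightarrow> M = N \<or> M = - N"
  unfolding pm_def by (metis (no_types, lifting) doubleton_eq_iff minus_minus)

abbreviation S_class where "S_class \<equiv> pm (mat2 0 (- 1) 1 0)"
abbreviation R_class where "R_class \<equiv> pm (mat2 0 (- 1) 1 1)"

text \<open>
  Up to sign, the product of the two generators is the elementary matrix \<open>T\<close> with upper right
  entry \<open>1\<close>.  Multiplication by \<open>T\<close> and by the generator of order two performs Euclid's algorithm on the
  first column.
\<close>
lemma S_R_generate: "generate PSL2Z {S_class, R_class} = carrier PSL2Z"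
proof -
  define U where "U = {M. det M = 1 \<and> pm M \<in> generate PSL2Z {S_class, R_class}}"
  have mult: "M ** N \<in> U" if "M \<in> U" "N \<in> U" for M N
    using that generate.eng[of "pm M" PSL2Z _ "pm N"] by (simp add: U_def mult_PSL2Z det_mul)
  have neg: "- M \<in> U" if "M \<in> U" for M
    using that by (cases "M = mat2 (M $ 1 $ 1) (M $ 1 $ 2) (M $ 2 $ 1) (M $ 2 $ 2)")
      (auto simp: U_def pm_uminus det_2 mat2_eta[symmetric])
  have S: "mat2 0 (- 1) 1 0 \<in> U" and R: "mat2 0 (- 1) 1 1 \<in> U"
    by (auto simp: U_def intro: generate.incl)
  have one: "mat2 1 0 0 1 \<in> U"
    using generate.one[of PSL2Z] by (simp add: U_def one_PSL2Z)
  have T: "mat2 1 1 0 1 \<in> U"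
    using neg[OF mult[OF S R]] by simp
  have T': "mat2 1 (- 1) 0 1 \<in> U"
    using neg[OF mult[OF mult[OF R R] S]] by simp
  have upper: "mat2 1 n 0 1 \<in> U" for n
    by (induction n rule: int_induct[of _ 0]) (use one mult T mult T' in \<open>force+\<close>)
  have "mat2 p q r s \<in> U" if "p * s - q * r = 1" for p q r s
    using that
  \<comment> \<open>The weight \<open>2\<close> makes the measure decrease also when \<open>p\<close> and \<open>r\<close> are swapped.\<close>
  proof (induction "nat (\<bar>p\<bar> + 2 * \<bar>r\<bar>)" arbitrary: p q r s rule: less_induct)
    case less
    consider "r = 0" | "\<bar>p\<bar> < \<bar>r\<bar>" | "r \<noteq> 0" "\<bar>r\<bar> \<le> \<bar>p\<bar>" "p * r > 0" | "r \<noteq> 0" "\<bar>r\<bar> \<le> \<bar>p\<bar>" "p * r < 0"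
      by (cases "r = 0"; cases "\<bar>p\<bar> < \<bar>r\<bar>"; cases "p * r" "0::int" rule: linorder_cases) auto
    then show ?case
    proof cases
      case 1
      then have "p = 1 \<and> s = 1 \<or> p = - 1 \<and> s = - 1" using less.prems by (auto simp: zmult_eq_1_iff)
      then show ?thesis using 1 upper[of q] neg[OF upper[of "- q"]] by auto
    next
      case 2
      then have "mat2 (- r) (- s) p q \<in> U" by (intro less) (use less.prems in \<open>auto simp: algebra_simps\<close>)
      from neg[OF mult[OF S this]] show ?thesis by simp
    next
      case 3
      then have "\<bar>p - r\<bar> < \<bar>p\<bar>" by (auto simp: zero_less_mult_iff)
      then have "mat2 (p - r) (q - s) r s \<in> U" by (intro less) (use less.prems in \<open>auto simp: algebra_simps\<close>)
      from mult[OF T this] show ?thesis by simp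
    next
      case 4
      then have "\<bar>p + r\<bar> < \<bar>p\<bar>" by (auto simp: mult_less_0_iff)
      then have "mat2 (p + r) (q + s) r s \<in> U" by (intro less) (use less.prems in \<open>auto simp: algebra_simps\<close>)
      from mult[OF T' this] show ?thesis by simp
    qed
  qed
  then have "M \<in> U" if "det M = 1" for M
    using that mat2_eta[of M] by (metis det_2 mat2_det)
  then have "carrier PSL2Z \<subseteq> generate PSL2Z {S_class, R_class}" by (auto simp: carrier_PSL2Z U_def)
  moreover have "generate PSL2Z {S_class, R_class} \<subseteq> carrier PSL2Z"
    by (rule PSL2Z.generate_incl) (auto simp: carrier_PSL2Z)
  ultimately show ?thesis by blast
qed

text \<open>
  Right multiplication acts on first rows \<open>(p, q)\<close> up to sign, that is, on the slopes \<open>q/p\<close> of the projective line.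
  The two generators act by \<open>x \<mapsto> -1/x\<close> and \<open>x \<mapsto> 1 - 1/x\<close>; the exits are the matrices with slope in
  \<open>(-\<infinity>, 0]\<close>.  The second generator rotates the half-open intervals \<open>(-\<infinity>, 0]\<close>, \<open>(1, \<infinity>]\<close>, \<open>(0, 1]\<close>
  cyclically, and the choice of endpoints lets rational slopes take part in the partition.
\<close>
definition first_row_flow :: "(int^2^2) set \<Rightarrow> bool"
  where "first_row_flow C \<longleftrightarrow> (\<exists>M\<in>C. M $ 1 $ 1 \<noteq> 0 \<and> M $ 1 $ 1 * M $ 1 $ 2 \<le> 0)"

lemma first_row_flow_pm: "first_row_flow (pm (mat2 p q r s)) \<longleftrightarrow> p \<noteq> 0 \<and> p * q \<le> 0"
  by (auto simp: first_row_flow_def pm_def)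

lemma modular_flow_PSL2Z: "modular_flow PSL2Z S_class R_class first_row_flow"
proof
  show "S_class \<in> carrier PSL2Z" "R_class \<in> carrier PSL2Z" by (auto simp: carrier_PSL2Z)
  show "S_class \<otimes>\<^bsub>PSL2Z\<^esub> S_class = \<one>\<^bsub>PSL2Z\<^esub>"
    "R_class \<otimes>\<^bsub>PSL2Z\<^esub> (R_class \<otimes>\<^bsub>PSL2Z\<^esub> R_class) = \<one>\<^bsub>PSL2Z\<^esub>"
    by (auto simp: mult_PSL2Z one_PSL2Z pm_mat2_eq_iff)
  show "generate PSL2Z {S_class, R_class} = carrier PSL2Z" by (rule S_R_generate)
  fix g assume "g \<in> carrier PSL2Z"
  then obtain M where "g = pm M" "det M = 1" by (auto simp: carrier_PSL2Z)
  then obtain p q r s where g: "g = pm (mat2 p q r s)" and det: "p * s - q * r = 1"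
    by (metis mat2_eta mat2_det)
  have gS: "g \<otimes>\<^bsub>PSL2Z\<^esub> S_class = pm (mat2 q (- p) s (- r))"
    and gR: "g \<otimes>\<^bsub>PSL2Z\<^esub> R_class = pm (mat2 q (q - p) s (s - r))"
    and gRR: "g \<otimes>\<^bsub>PSL2Z\<^esub> R_class \<otimes>\<^bsub>PSL2Z\<^esub> R_class = pm (mat2 (q - p) (- p) (s - r) (- r))"
    using det by (simp_all add: g mult_PSL2Z algebra_simps)
  have pq: "p \<noteq> 0 \<or> q \<noteq> 0" using det by auto
  show "first_row_flow (g \<otimes>\<^bsub>PSL2Z\<^esub> S_class) \<longleftrightarrow> \<not> first_row_flow g"
    using pq unfolding gS unfolding g first_row_flow_pm by (auto simp: mult_le_0_iff zero_le_mult_iff)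
  show "first_row_flow g \<or> first_row_flow (g \<otimes>\<^bsub>PSL2Z\<^esub> R_class) \<or>
      first_row_flow (g \<otimes>\<^bsub>PSL2Z\<^esub> R_class \<otimes>\<^bsub>PSL2Z\<^esub> R_class)"
    using pq unfolding gRR unfolding gR unfolding g first_row_flow_pm by (auto simp: mult_le_0_iff zero_le_mult_iff)
  show "\<not> first_row_flow (g \<otimes>\<^bsub>PSL2Z\<^esub> R_class)" if "first_row_flow g"
    using that pq unfolding gR unfolding g first_row_flow_pm by (auto simp: mult_le_0_iff)
qed

section \<open>A piecewise affine action on the circle\<close>

definition half_turn :: "real \<Rightarrow> real"
  where "half_turn = (\<lambda>x\<in>circle. if x < 1/2 then x + 1/2 else x - 1/2)"

text \<open>
  This rotates the arcs \<open>[0,1/2)\<close>, \<open>[1/2,3/4)\<close>, \<open>[3/4,1)\<close> cyclically, each of them affinely.  The two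
  rotations together generate a copy of the modular group inside Thompson's group \<open>T\<close>.
\<close>
definition third_turn :: "real \<Rightarrow> real"
  where "third_turn = (\<lambda>x\<in>circle. if x < 1/2 then x / 2 + 1/2 else if x < 3/4 then x + 1/4 else 2 * x - 3/2)"

lemma half_turn_in_circle: "x \<in> circle \<Longrightarrow> half_turn x \<in> circle"
  and third_turn_in_circle: "x \<in> circle \<Longrightarrow> third_turn x \<in> circle"
  by (auto simp: half_turn_def third_turn_def circle_def)

lemma half_turn_square: "x \<in> circle \<Longrightarrow> half_turn (half_turn x) = x"
  by (auto simp: half_turn_def circle_def)

lemma third_turn_cube: "x \<in> circle \<Longrightarrow> third_turn (third_turn (third_turn x)) = x"
  by (auto simp: third_turn_def circle_def field_simps)

lemma half_turn_Bij: "half_turn \<in> Bij circle"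
proof -
  have "bij_betw half_turn circle circle"
    by (rule bij_betw_byWitness[of _ half_turn]) (auto simp: half_turn_square half_turn_in_circle)
  then show ?thesis by (simp add: Bij_def half_turn_def)
qed

lemma third_turn_Bij: "third_turn \<in> Bij circle"
proof -
  have "bij_betw third_turn circle circle"
    by (rule bij_betw_byWitness[of _ "\<lambda>x. third_turn (third_turn x)"])
      (auto simp: third_turn_cube third_turn_in_circle)
  then show ?thesis by (simp add: Bij_def third_turn_def)
qed

lemma frac_on_closed: "0 \<le> x \<Longrightarrow> x \<le> 1 \<Longrightarrow> frac (x::real) = (if x = 1 then 0 else x)"
  by (auto simp: frac_eq)

lemma PA_half_turn: "PA_rational_homeo half_turn"
  unfolding PA_rational_homeo_def
proof (rule conjI[OF half_turn_Bij], rule exI[of _ 2], rule exI[of _ "\<lambda>i. real i / 2"],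
    rule exI[of _ "\<lambda>_. 1"], rule exI[of _ "\<lambda>i. if i = 0 then 1/2 else - 1/2"],
    intro conjI allI impI ballI)
  fix i x assume "i < (2::nat)" and x: "x \<in> {real i / 2..real (Suc i) / 2}"
  then consider "i = 0" | "i = 1" by linarith
  note cases = this
  show "1 * x + (if i = 0 then 1/2 else - 1/2) \<in> {0..1}"
    using cases by cases (use x in auto)
  show "half_turn (frac x) = frac (1 * x + (if i = 0 then 1/2 else - 1/2))"
    using cases by cases (use x in \<open>auto simp: frac_on_closed half_turn_def circle_def\<close>)
qed auto

lemma PA_third_turn: "PA_rational_homeo third_turn"
  unfolding PA_rational_homeo_def
proof (rule conjI[OF third_turn_Bij], rule exI[of _ 3],
    rule exI[of _ "\<lambda>i. if i = 0 then 0 else if i = 1 then 1/2 else if i = 2 then 3/4 else 1"],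
    rule exI[of _ "\<lambda>i. if i = 0 then 1/2 else if i = 1 then 1 else 2"],
    rule exI[of _ "\<lambda>i. if i = 0 then 1/2 else if i = 1 then 1/4 else - 3/2"],
    intro conjI allI impI ballI)
  fix i :: nat and x :: real
  assume "i < 3" and x: "x \<in> {if i = 0 then 0 else if i = 1 then 1/2 else if i = 2 then 3/4 else 1..
    if Suc i = 0 then 0 else if Suc i = 1 then 1/2 else if Suc i = 2 then 3/4 else 1}"
  then consider "i = 0" | "i = 1" | "i = 2" by linarith
  note cases = this
  show "(if i = 0 then 1/2 else if i = 1 then 1 else 2) * x +
      (if i = 0 then 1/2 else if i = 1 then 1/4 else - 3/2) \<in> {0..1}"
    using cases by cases (use x in auto)
  show "third_turn (frac x) = frac ((if i = 0 then 1/2 else if i = 1 then 1 else 2) * x +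
      (if i = 0 then 1/2 else if i = 1 then 1/4 else - 3/2))"
    using cases by cases (use x in \<open>auto simp: frac_on_closed third_turn_def circle_def\<close>)
qed (auto simp: less_Suc_eq numeral_3_eq_3)

abbreviation circle_group :: "(real \<Rightarrow> real) monoid"
  where "circle_group \<equiv> subgroup_generated (BijGroup circle) {half_turn, third_turn}"

lemma circle_group_Bij: "carrier circle_group \<subseteq> Bij circle"
  using group.carrier_subgroup_generated_subset[OF group_BijGroup] by (auto simp: BijGroup_def)

lemma circle_group_mult:
  "f \<in> carrier circle_group \<Longrightarrow> g \<in> carrier circle_group \<Longrightarrow> f \<otimes>\<^bsub>circle_group\<^esub> g = compose circle f g"
  using circle_group_Bij by (auto simp: BijGroup_def)

lemma circle_group_one: "\<one>\<^bsub>circle_group\<^esub> = (\<lambda>x\<in>circle. x)"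
  by (simp add: BijGroup_def)

lemma generators_in_circle_group: "half_turn \<in> carrier circle_group" "third_turn \<in> carrier circle_group"
  by (auto simp: carrier_subgroup_generated BijGroup_def half_turn_Bij third_turn_Bij intro: generate.incl)

lemma modular_generators_circle: "modular_generators circle_group half_turn third_turn"
proof -
  interpret B: group "BijGroup circle" by (rule group_BijGroup)
  interpret \<Gamma>: group circle_group by simp
  show ?thesis
  proof
    show "half_turn \<otimes>\<^bsub>circle_group\<^esub> half_turn = \<one>\<^bsub>circle_group\<^esub>"
      by (auto simp del: mult_subgroup_generated one_subgroup_generated
        simp: circle_group_mult circle_group_one generators_in_circle_group compose_def half_turn_square)
    show "third_turn \<otimes>\<^bsub>circle_group\<^esub> (third_turn \<otimes>\<^bsub>circle_group\<^esub> third_turn) = \<one>\<^bsub>circle_group\<^esub>"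
      using \<Gamma>.m_closed[OF generators_in_circle_group(2,2)]
      by (auto simp del: mult_subgroup_generated one_subgroup_generated
        simp: circle_group_mult circle_group_one generators_in_circle_group compose_def
          third_turn_cube third_turn_in_circle)
    have "generate circle_group (carrier circle_group \<inter> {half_turn, third_turn}) = carrier circle_group"
      by (metis B.subgroup_generated2 carrier_subgroup_generated)
    then show "generate circle_group {half_turn, third_turn} = carrier circle_group"
      using generators_in_circle_group by (simp add: Int_absorb1)
  qed (rule generators_in_circle_group)+
qed

text \<open>
  The statement covers the whole circle as well as a single orbit.
\<close>
lemma modular_action_invariant:
  assumes "\<Omega> \<subseteq> circle" and "\<And>f x. f \<in> carrier circle_group \<Longrightarrow> x \<in> \<Omega> \<Longrightarrow> f x \<in> \<Omega>"
  shows "modular_action circle_group half_turn third_turn \<Omega> {0..<1/2} (\<lambda>f. f)"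
proof -
  interpret \<Gamma>: modular_generators circle_group half_turn third_turn by (rule modular_generators_circle)
  show ?thesis
  proof
    show "(f \<otimes>\<^bsub>circle_group\<^esub> g) x = f (g x)"
      if "f \<in> carrier circle_group" "g \<in> carrier circle_group" "x \<in> \<Omega>" for f g x
      using that assms(1) by (auto simp: circle_group_mult compose_def simp del: mult_subgroup_generated)
    show "\<one>\<^bsub>circle_group\<^esub> x = x" if "x \<in> \<Omega>" for x
      using that assms(1) by (auto simp: circle_group_one simp del: one_subgroup_generated)
    fix x assume "x \<in> \<Omega>"
    then have x: "x \<in> circle" using assms(1) by blast
    show "half_turn x \<in> {0..<1/2} \<longleftrightarrow> x \<notin> {0..<1/2}"
      using x by (auto simp: half_turn_def circle_def)
    show "x \<in> {0..<1/2} \<or> third_turn x \<in> {0..<1/2} \<or> third_turn (third_turn x) \<in> {0..<1/2}"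
      using x by (auto simp: third_turn_def circle_def)
    show "third_turn x \<notin> {0..<1/2}" if "x \<in> {0..<1/2}"
      using x that by (auto simp: third_turn_def circle_def)
  qed (rule assms(2))
qed

section \<open>The modular group on the circle and its subshift\<close>

text \<open>
  If \<open>g\<close> fixes all points of the orbit of \<open>t\<close>, it acts trivially on a nonempty invariant set, and
  faithfulness of the action on that orbit yields that \<open>g\<close> is the identity.
\<close>
theorem PA_recognizable_of_modular_flow:
  assumes "modular_flow G a b E"
  shows "PA_recognizable G"
proof -
  interpret G: modular_flow G a b E by fact
  interpret \<Gamma>: modular_generators circle_group half_turn third_turn by (rule modular_generators_circle)
  have inv: "f x \<in> circle" if "f \<in> carrier circle_group" "x \<in> circle" for f x
    using that circle_group_Bij Bij_imp_funcset by blast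
  have iso: "circle_group \<cong> G"
  proof (rule modular_groups_isomorphic)
    show "modular_action circle_group half_turn third_turn circle {0..<1/2} (\<lambda>f. f)"
      by (rule modular_action_invariant) (use inv in auto)
    show "circle \<noteq> {}" by (simp add: circle_def)
    show "carrier G \<noteq> {}" by auto
  qed (rule G.modular_action_right)
  have "g = \<one>\<^bsub>circle_group\<^esub>"
    if t: "t \<in> circle" and g: "g \<in> carrier circle_group"
      and fix_orbit: "\<And>f. f \<in> carrier circle_group \<Longrightarrow> g (f t) = f t"
    for t g
  proof -
    define \<Omega> where "\<Omega> = (\<lambda>f. f t) ` carrier circle_group"
    interpret modular_action circle_group half_turn third_turn \<Omega> "{0..<1/2}" "\<lambda>f. f"
    proof (rule modular_action_invariant)
      show "\<Omega> \<subseteq> circle" using inv t by (auto simp: \<Omega>_def)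
      fix f x assume f: "f \<in> carrier circle_group" and "x \<in> \<Omega>"
      then obtain k where k: "k \<in> carrier circle_group" "x = k t" by (auto simp: \<Omega>_def)
      then have "f x = (f \<otimes>\<^bsub>circle_group\<^esub> k) t"
        using f t by (simp add: circle_group_mult compose_def del: mult_subgroup_generated)
      then show "f x \<in> \<Omega>" using f k(1) \<Gamma>.m_closed unfolding \<Omega>_def by blast
    qed
    show ?thesis
      by (rule faithful) (use g fix_orbit \<Gamma>.one_closed in \<open>auto simp: \<Omega>_def simp del: one_subgroup_generated\<close>)
  qed
  moreover have "finitely_generated_group G"
    unfolding finitely_generated_group_def
    by (intro conjI exI[of _ "{a, b}"] G.is_group G.generators) auto
  ultimately show ?thesis
    unfolding PA_recognizable_def Let_def
  proof (intro conjI exI[of _ "{half_turn, third_turn}"])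
    show "\<forall>f\<in>{half_turn, third_turn}. PA_rational_homeo f"
      using PA_half_turn PA_third_turn by blast
  qed (use iso in blast)+
qed

theorem proposition5p8:
  "PA_recognizable PSL2Z \<and> admits_strongly_aperiodic_SFT (integer_group \<times>\<times> PSL2Z)"
proof
  show "PA_recognizable PSL2Z"
    by (rule PA_recognizable_of_modular_flow[OF modular_flow_PSL2Z])
  show "admits_strongly_aperiodic_SFT (integer_group \<times>\<times> PSL2Z)"
    by (rule modular_flow.integers_times_modular_admits_SFT[OF modular_flow_PSL2Z])
qed

end
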